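(* Let $n\ge 1$, let $P\subset\mathbb{R}^n$ be a full-dimensional polytope, and let $S_P$ be a slack matrix of $P$. Then $\operatorname{rank}_{\mathrm{psd}} P=n+1$ if and only if $\operatorname{rank}_{\sqrt{\ }}\, S_P=n+1$.
   Context: $\mathcal{S}_+^k$ denotes the cone of $k\times k$ real symmetric positive semidefinite (psd) matrices. An $\mathcal{S}_+^k$-lift of a polytope $P\subset\mathbb{R}^n$ is a set $\mathcal{S}_+^k\cap L$, with $L$ an affine subspace of the space of real symmetric $k\times k$ matrices, such that $P=\pi(\mathcal{S}_+^k\cap L)$ for some linear map $\pi$ to $\mathbb{R}^n$. The psd rank $\operatorname{rank}_{\mathrm{psd}}P$ is the smallest positive integer $k$ such that $P$ has an $\mathcal{S}_+^k$-lift. Slack matrix: let $P\subset\mathbb{R}^n$ be a full-dimensional polytope with vertices $p_1,\dots,p_v$ and irredundant (facet) inequality representation $P=\{x\in\mathbb{R}^n:\beta_j-\langle a_j,x\rangle\ge 0,\ j=1,\dots,f\}$. The $v\times f$ nonnegative matrix with $(i,j)$-entry $\beta_j-\langle a_j,p_i\rangle$ is called a slack matrix of $P$ (defined up to positive scalings of its columns). A Hadamard square root of a nonnegative real matrix $M$ is any real matrix $\sqrt{M}$ of the same size whose $(i,j)$-entry is a square root (positive or negative) of the $(i,j)$-entry of $M$. $\operatorname{rank}_{\sqrt{\ }}\,M$ denotes the minimum rank of a Hadamard square root of $M$. *)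

theory Defs
  imports "HOL-Analysis.Analysis" "Jordan_Normal_Form.DL_Rank"
begin

text \<open>
  Matrices whose size has to be quantified over are of type \<^typ>\<open>real mat\<close>; points of
  \<open>\<real>\<^sup>n\<close> are of type \<open>real^'n\<close>. The symbols for inner products are overloaded between
  the two libraries, so \<^const>\<open>inner\<close> and \<^const>\<open>scalar_prod\<close> are written in prefix form.
\<close>

definition sym_mats :: "nat \<Rightarrow> real mat set" where
  "sym_mats k = {A \<in> carrier_mat k k. transpose_mat A = A}"

definition psd_cone :: "nat \<Rightarrow> real mat set" where
  "psd_cone k = {A \<in> sym_mats k. \<forall>x \<in> carrier_vec k. scalar_prod x (A *\<^sub>v x) \<ge> 0}"

text \<open>
  The type \<^typ>\<open>real mat\<close> contains matrices of all sizes and is not a real vector space, so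
  \<^const>\<open>affine\<close> and \<^const>\<open>linear\<close> are restated relative to the space of symmetric
  \<open>k \<times> k\<close> matrices. As for \<^const>\<open>affine\<close>, the empty set is allowed.
\<close>

definition affine_in_sym :: "nat \<Rightarrow> real mat set \<Rightarrow> bool" where
  "affine_in_sym k L \<longleftrightarrow> L \<subseteq> sym_mats k \<and>
     (\<forall>A\<in>L. \<forall>B\<in>L. \<forall>u v. u + v = 1 \<longrightarrow> u \<cdot>\<^sub>m A + v \<cdot>\<^sub>m B \<in> L)"

definition linear_on_sym :: "nat \<Rightarrow> (real mat \<Rightarrow> 'a::real_vector) \<Rightarrow> bool" where
  "linear_on_sym k \<pi> \<longleftrightarrow>
     (\<forall>A\<in>sym_mats k. \<forall>B\<in>sym_mats k. \<pi> (A + B) = \<pi> A + \<pi> B) \<and>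
     (\<forall>A\<in>sym_mats k. \<forall>c. \<pi> (c \<cdot>\<^sub>m A) = c *\<^sub>R \<pi> A)"

definition has_psd_lift :: "nat \<Rightarrow> 'a::real_vector set \<Rightarrow> bool" where
  "has_psd_lift k P \<longleftrightarrow>
     (\<exists>L \<pi>. affine_in_sym k L \<and> linear_on_sym k \<pi> \<and> P = \<pi> ` (psd_cone k \<inter> L))"

definition psd_rank :: "'a::real_vector set \<Rightarrow> nat" where
  "psd_rank P = (LEAST k. k > 0 \<and> has_psd_lift k P)"

text \<open>The inequalities are \<open>b j - \<langle>a j, x\<rangle> \<ge> 0\<close> for \<open>j < f\<close>, none of which can be dropped.
  For full-dimensional \<open>P\<close> they correspond bijectively to the facets of \<open>P\<close>.\<close>

definition irredundant_rep ::
    "'a::euclidean_space set \<Rightarrow> nat \<Rightarrow> (nat \<Rightarrow> 'a) \<Rightarrow> (nat \<Rightarrow> real) \<Rightarrow> bool" where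
  "irredundant_rep P f a b \<longleftrightarrow>
     P = {x. \<forall>j<f. b j - inner (a j) x \<ge> 0} \<and>
     (\<forall>i<f. P \<noteq> {x. \<forall>j<f. j \<noteq> i \<longrightarrow> b j - inner (a j) x \<ge> 0})"

text \<open>A slack matrix depends on the order of vertices and facets and on the scaling of the
  inequalities, so being a slack matrix is a predicate.\<close>

definition slack_matrix :: "'a::euclidean_space set \<Rightarrow> real mat \<Rightarrow> bool" where
  "slack_matrix P S \<longleftrightarrow>
     (\<exists>v f p a b. bij_betw p {..<v} {x. x extreme_point_of P} \<and>
        irredundant_rep P f a b \<and>
        S = mat v f (\<lambda>(i, j). b j - inner (a j) (p i)))"

definition hadamard_sqrt :: "real mat \<Rightarrow> real mat \<Rightarrow> bool" where
  "hadamard_sqrt M N \<longleftrightarrow> N \<in> carrier_mat (dim_row M) (dim_col M) \<and>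
     (\<forall>i<dim_row M. \<forall>j<dim_col M. (N $$ (i, j))\<^sup>2 = M $$ (i, j))"

definition mat_rank :: "real mat \<Rightarrow> nat" where
  "mat_rank M = vec_space.rank (dim_row M) M"

definition sqrt_rank :: "real mat \<Rightarrow> nat" where
  "sqrt_rank M = (LEAST r. \<exists>N. hadamard_sqrt M N \<and> mat_rank N = r)"

end

theory Submission
  imports Defs
begin

text \<open>
  Let \<open>P = \<pi>(S\<^sub>+ \<inter> L)\<close> be a lift of size at most \<open>n + 1\<close>. To a face \<open>F\<close> of \<open>P\<close> attach the
  common kernel of the matrices lying over \<open>F\<close>. It shrinks strictly as \<open>F\<close> grows, and along a flag
  there are \<open>n + 1\<close> faces, so the size is exactly \<open>n + 1\<close> and the kernel over \<open>F\<close> has dimension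
  \<open>n - dim F\<close>. Over a vertex there is therefore a matrix \<open>u u\<^sup>T\<close>, over a facet the kernel is a
  line \<open>\<real>w\<close>, and a perturbation argument shows that the slack of the facet is \<open>w\<^sup>T Y w\<close> on \<open>L\<close>,
  after scaling \<open>w\<close>. So the slack matrix has the entries \<open>\<langle>u\<^sub>i, w\<^sub>j\<rangle>\<^sup>2\<close>. No separation theorem or
  conic duality is needed.

  Conversely, a Hadamard square root \<open>\<langle>u\<^sub>i, w\<^sub>j\<rangle>\<close> yields a lift: \<open>L\<close> consists of the \<open>Y\<close> for which
  the numbers \<open>w\<^sub>j\<^sup>T Y w\<^sub>j\<close> are the slacks of a point. Finally, every Hadamard square root has rank at
  least \<open>n + 1\<close> because of its zero pattern alone, again by following a flag of faces.
\<close>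

no_notation scalar_prod (infix "\<bullet>" 70)
no_notation vec_index (infixl "$" 100)

section \<open>Positive semidefinite matrices\<close>

lemma linear_in_parameter_zero:
  fixes a c :: real
  assumes "\<And>t. 0 \<le> a + t * c"
  shows "c = 0"
proof (rule ccontr)
  assume "c \<noteq> 0"
  then show False
    \<comment> \<open>At this \<open>t\<close> the expression equals -1.\<close>
    using assms[of "- (a + 1) / c"] by simp
qed

lemma symmetric_matrix_inner:
  fixes Y :: "real^'m^'m"
  assumes "Finite_Cartesian_Product.transpose Y = Y"
  shows "x \<bullet> (Y *v y) = (Y *v x) \<bullet> y"
  using assms by (metis dot_lmul_matrix transpose_matrix_vector)

text \<open>Counterpart of \<open>psd_cone\<close> on the Euclidean space \<open>real^'m^'m\<close>,
  where compactness, dimension and affine sets are at hand.\<close>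

definition psd :: "real^'m^'m \<Rightarrow> bool" where
  "psd Y \<longleftrightarrow> Finite_Cartesian_Product.transpose Y = Y \<and> (\<forall>x. 0 \<le> x \<bullet> (Y *v x))"

lemma psd_transpose: "psd Y \<Longrightarrow> Finite_Cartesian_Product.transpose Y = Y"
  by (simp add: psd_def)

lemma psd_nonneg: "psd Y \<Longrightarrow> 0 \<le> x \<bullet> (Y *v x)"
  by (simp add: psd_def)

lemma subspace_null_space:
  fixes Y :: "real^'m^'m"
  shows "Real_Vector_Spaces.subspace {x. Y *v x = 0}"
  by (simp add: real_vector.subspace_def matrix_vector_right_distrib matrix_vector_mult_scaleR)

lemma transpose_linear_combination:
  fixes Y Z :: "real^'m^'m"
  shows "Finite_Cartesian_Product.transpose (u *\<^sub>R Y + v *\<^sub>R Z) =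
    u *\<^sub>R Finite_Cartesian_Product.transpose Y + v *\<^sub>R Finite_Cartesian_Product.transpose Z"
  by (simp add: Finite_Cartesian_Product.transpose_def Finite_Cartesian_Product.vec_eq_iff)

lemma linear_combination_mult_vec:
  fixes Y Z :: "real^'m^'m"
  shows "(u *\<^sub>R Y + v *\<^sub>R Z) *v x = u *\<^sub>R (Y *v x) + v *\<^sub>R (Z *v x)"
  by (simp add: matrix_vector_mult_add_rdistrib scaleR_matrix_vector_assoc)

lemma psd_nonneg_combination:
  assumes "psd Y" "psd Z" "0 \<le> u" "0 \<le> v"
  shows "psd (u *\<^sub>R Y + v *\<^sub>R Z)"
  using assms
  by (simp add: psd_def transpose_linear_combination linear_combination_mult_vec inner_add_right)

text \<open>With \<open>y = Y *v x\<close>, the form at \<open>x - s *\<^sub>R y\<close> is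
  \<open>s\<^sup>2 * c - 2 * s * N\<close>. For small positive \<open>s\<close> the linear term
  makes it negative unless \<open>N = 0\<close>.\<close>

lemma psd_null_vector:
  assumes "psd Y" "x \<bullet> (Y *v x) = 0"
  shows "Y *v x = 0"
proof -
  define y where "y = Y *v x"
  define N c where "N = y \<bullet> y" and "c = y \<bullet> (Y *v y)"
  have "0 \<le> c" unfolding c_def using assms(1) by (rule psd_nonneg)
  have "0 \<le> N" by (simp add: N_def)
  have *: "0 \<le> s\<^sup>2 * c - 2 * s * N" for s
  proof -
    have "0 \<le> (x - s *\<^sub>R y) \<bullet> (Y *v (x - s *\<^sub>R y))"
      using assms(1) by (rule psd_nonneg)
    also have "\<dots> = s\<^sup>2 * c - 2 * s * N"
      using assms(2) symmetric_matrix_inner[OF psd_transpose[OF assms(1)], of x y]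
      by (simp add: y_def N_def c_def matrix_vector_mult_diff_distrib matrix_vector_mult_scaleR
          inner_diff_left inner_diff_right power2_eq_square algebra_simps)
    finally show ?thesis .
  qed
  have "N = 0"
  proof (rule ccontr)
    assume "N \<noteq> 0"
    with \<open>0 \<le> N\<close> have "0 < N" by simp
    \<comment> \<open>The denominator stays positive for \<open>c = 0\<close>, and
      \<open>s * c \<le> N\<close> contradicts \<open>2 * N \<le> s * c\<close>.\<close>
    define s where "s = N / (c + 1)"
    have "0 < s" using \<open>0 < N\<close> \<open>0 \<le> c\<close> by (simp add: s_def)
    have "0 \<le> s * (s * c - 2 * N)" using *[of s] by (simp add: power2_eq_square algebra_simps)
    then have "2 * N \<le> s * c" using \<open>0 < s\<close> by (simp add: zero_le_mult_iff)
    moreover have "s * c \<le> N"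
      using \<open>0 < N\<close> \<open>0 \<le> c\<close> by (simp add: s_def field_simps)
    ultimately show False using \<open>0 < N\<close> by simp
  qed
  then show ?thesis by (simp add: N_def y_def)
qed

text \<open>Two nonnegative numbers with a vanishing positive combination are both zero, and a zero
  of the form is a null vector.\<close>

lemma psd_sum_null_vector:
  assumes "psd Y" "psd Z" "(u *\<^sub>R Y + v *\<^sub>R Z) *v x = 0" "0 < u" "0 < v"
  shows "Y *v x = 0" "Z *v x = 0"
proof -
  have "u * (x \<bullet> (Y *v x)) + v * (x \<bullet> (Z *v x)) = x \<bullet> ((u *\<^sub>R Y + v *\<^sub>R Z) *v x)"
    by (simp add: linear_combination_mult_vec inner_add_right)
  also have "\<dots> = 0" using assms(3) by simp
  finally have *: "u * (x \<bullet> (Y *v x)) + v * (x \<bullet> (Z *v x)) = 0" .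
  have "0 \<le> u * (x \<bullet> (Y *v x))" "0 \<le> v * (x \<bullet> (Z *v x))"
    using assms psd_nonneg by (simp_all add: psd_nonneg)
  with * have "x \<bullet> (Y *v x) = 0" "x \<bullet> (Z *v x) = 0"
    using assms(4,5) by (auto simp: add_nonneg_eq_0_iff)
  then show "Y *v x = 0" "Z *v x = 0"
    using assms(1,2) psd_null_vector by blast+
qed

text \<open>The form attains a minimum on the compact unit sphere of the orthogonal complement of
  the kernel. It is positive, since a zero would lie in the kernel and be orthogonal to itself.
  Homogeneity does the rest.\<close>

lemma psd_coercive:
  assumes "psd Y"
  obtains m where "0 < m" "\<And>y. (\<And>z. Y *v z = 0 \<Longrightarrow> z \<bullet> y = 0) \<Longrightarrow> m * (norm y)\<^sup>2 \<le> y \<bullet> (Y *v y)"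
proof -
  define C where "C = {y. \<forall>z. Y *v z = 0 \<longrightarrow> z \<bullet> y = 0}"
  define f where "f = (\<lambda>y. y \<bullet> (Y *v y))"
  have "closed {y. z \<bullet> y = 0}" for z :: "real^'a" by (rule closed_hyperplane)
  moreover have "C = (\<Inter>z\<in>{z. Y *v z = 0}. {y. z \<bullet> y = 0})" by (auto simp: C_def)
  ultimately have "closed C" by auto
  then have "compact (sphere 0 1 \<inter> C)" by (rule compact_Int_closed[OF compact_sphere])
  have cont: "continuous_on (sphere 0 1 \<inter> C) f"
    unfolding f_def by (intro continuous_intros matrix_vector_mult_linear_continuous_on)
  have "\<exists>m>0. \<forall>y\<in>sphere 0 1 \<inter> C. m \<le> f y"
  proof (cases "sphere 0 1 \<inter> C = {}")
    case True
    \<comment> \<open>An invertible complement is missing here: it is \<open>{0}\<close>, so any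
      positive constant serves.\<close>
    then show ?thesis by (intro exI[of _ 1]) auto
  next
    case False
    from continuous_attains_inf[OF \<open>compact (sphere 0 1 \<inter> C)\<close> False cont]
    obtain y where y: "y \<in> sphere 0 1" "y \<in> C" "\<forall>y'\<in>sphere 0 1 \<inter> C. f y \<le> f y'" by auto
    have "f y \<noteq> 0"
    proof
      assume "f y = 0"
      then have "Y *v y = 0" using psd_null_vector[OF assms] by (simp add: f_def)
      then have "y \<bullet> y = 0" using y(2) by (auto simp: C_def)
      then show False using y(1) by simp
    qed
    moreover have "0 \<le> f y" using assms by (simp add: f_def psd_nonneg)
    ultimately show ?thesis using y(3) by (intro exI[of _ "f y"]) auto
  qed
  then obtain m where m: "0 < m" "\<And>y. y \<in> sphere 0 1 \<inter> C \<Longrightarrow> m \<le> f y" by blast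
  have "m * (norm y)\<^sup>2 \<le> f y" if "y \<in> C" for y
  proof (cases "y = 0")
    case False
    have "(1 / norm y) *\<^sub>R y \<in> sphere 0 1 \<inter> C"
      using False that by (auto simp: C_def)
    then have "m \<le> f ((1 / norm y) *\<^sub>R y)" by (rule m(2))
    also have "\<dots> = f y / (norm y)\<^sup>2"
      by (simp add: f_def matrix_vector_mult_scaleR power2_eq_square field_simps)
    finally show ?thesis using False by (simp add: field_simps)
  qed (simp add: f_def)
  then show thesis using m(1) that by (auto simp: C_def f_def)
qed

text \<open>Split \<open>x = z + y\<close> along the kernel of \<open>Y\<close> and its complement.
  The hypothesis \<open>null\<close> absorbs the mixed term
  \<open>2 * (y \<bullet> (D *v z))\<close>, so \<open>D\<close> can lose only a multiple of the
  squared norm of \<open>y\<close>, which coercivity of \<open>Y\<close> repays. It covers both a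
  \<open>D\<close> that vanishes on the kernel and a \<open>D\<close> that is positive on a kernel
  of dimension one.\<close>

lemma psd_perturbation:
  fixes D :: "real^'m^'m"
  assumes "psd Y" and D: "Finite_Cartesian_Product.transpose D = D" and "0 < \<delta>"
    and null: "\<And>z. Y *v z = 0 \<Longrightarrow> \<delta> * (norm (D *v z))\<^sup>2 \<le> z \<bullet> (D *v z)"
  obtains \<epsilon> where "0 < \<epsilon>" "psd (Y + \<epsilon> *\<^sub>R D)"
proof -
  obtain m where "0 < m" and
    m: "\<And>y. (\<And>z. Y *v z = 0 \<Longrightarrow> z \<bullet> y = 0) \<Longrightarrow> m * (norm y)\<^sup>2 \<le> y \<bullet> (Y *v y)"
    using psd_coercive[OF assms(1)] by blast
  obtain M where "0 < M" and M: "\<And>x. norm (D *v x) \<le> norm x * M"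
    using bounded_linear.pos_bounded[OF matrix_vector_mul_bounded_linear, of D] by blast
  \<comment> \<open>Chosen so that \<epsilon> times the largest loss \<open>1 / \<delta> + M\<close>
    is exactly the gain \<open>m\<close>.\<close>
  define \<epsilon> where "\<epsilon> = m / (1 / \<delta> + M)"
  have c: "0 < 1 / \<delta> + M" using \<open>0 < \<delta>\<close> \<open>0 < M\<close> by (simp add: add_pos_pos)
  have "0 < \<epsilon>" using c \<open>0 < m\<close> by (simp add: \<epsilon>_def)
  have "0 \<le> x \<bullet> ((Y + \<epsilon> *\<^sub>R D) *v x)" for x
  proof -
    obtain z y where zy: "z \<in> span {x. Y *v x = 0}"
      "\<And>w. w \<in> span {x. Y *v x = 0} \<Longrightarrow> real_inner_class.orthogonal y w" "x = z + y"
      using orthogonal_subspace_decomp_exists by blast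
    have "Y *v z = 0"
      using zy(1) real_vector.span_eq_iff[THEN iffD2, OF subspace_null_space[of Y]] by simp
    have "z' \<bullet> y = 0" if "Y *v z' = 0" for z'
      using zy(2)[of z'] that real_vector.span_base[of z' "{x. Y *v x = 0}"]
      by (simp add: real_inner_class.orthogonal_def inner_commute)
    then have "m * (norm y)\<^sup>2 \<le> y \<bullet> (Y *v y)" by (rule m)
    also have "y \<bullet> (Y *v y) = x \<bullet> (Y *v x)"
      using \<open>Y *v z = 0\<close> symmetric_matrix_inner[OF psd_transpose[OF assms(1)], of z y]
      by (simp add: zy(3) matrix_vector_right_distrib inner_add_left)
    finally have 1: "m * (norm y)\<^sup>2 \<le> x \<bullet> (Y *v x)" .
    define d where "d = norm (D *v z)"
    have "y \<bullet> (D *v z) \<ge> - (norm y * d)"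
      using Cauchy_Schwarz_ineq2[of y "D *v z"] by (simp add: d_def abs_le_iff)
    moreover have "y \<bullet> (D *v y) \<ge> - (M * (norm y)\<^sup>2)"
    proof -
      have "\<bar>y \<bullet> (D *v y)\<bar> \<le> norm y * norm (D *v y)" by (rule Cauchy_Schwarz_ineq2)
      also have "\<dots> \<le> norm y * (norm y * M)" by (rule mult_left_mono[OF M]) simp
      finally show ?thesis by (simp add: power2_eq_square abs_le_iff algebra_simps)
    qed
    moreover have "\<delta> * d\<^sup>2 \<le> z \<bullet> (D *v z)" using null[OF \<open>Y *v z = 0\<close>] by (simp add: d_def)
    moreover have "x \<bullet> (D *v x) = z \<bullet> (D *v z) + 2 * (y \<bullet> (D *v z)) + y \<bullet> (D *v y)"
      using symmetric_matrix_inner[OF D, of z y]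
      by (simp add: zy(3) matrix_vector_right_distrib inner_add_left inner_add_right inner_commute)
    \<comment> \<open>Completing the square in \<open>d\<close>.\<close>
    moreover have "\<delta> * d\<^sup>2 - 2 * (norm y * d) \<ge> - (1 / \<delta> * (norm y)\<^sup>2)"
    proof -
      have "0 \<le> (\<delta> * d - norm y)\<^sup>2 / \<delta>" using \<open>0 < \<delta>\<close> by simp
      also have "\<dots> = \<delta> * d\<^sup>2 - 2 * (norm y * d) + 1 / \<delta> * (norm y)\<^sup>2"
        using \<open>0 < \<delta>\<close> by (simp add: field_simps power2_eq_square)
      finally show ?thesis by simp
    qed
    ultimately have 2: "x \<bullet> (D *v x) \<ge> - ((1 / \<delta> + M) * (norm y)\<^sup>2)"
      by (simp add: algebra_simps)
    have "\<epsilon> * (x \<bullet> (D *v x)) \<ge> \<epsilon> * (- ((1 / \<delta> + M) * (norm y)\<^sup>2))"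
      using 2 \<open>0 < \<epsilon>\<close> by (intro mult_left_mono) auto
    moreover have "\<epsilon> * (- ((1 / \<delta> + M) * (norm y)\<^sup>2)) = - (m * (norm y)\<^sup>2)"
      using c by (simp add: \<epsilon>_def)
    ultimately have "0 \<le> x \<bullet> (Y *v x) + \<epsilon> * (x \<bullet> (D *v x))" using 1 by linarith
    then show ?thesis
      by (simp add: matrix_vector_mult_add_rdistrib flip: scaleR_matrix_vector_assoc)
        (simp add: inner_add_right)
  qed
  moreover have "Finite_Cartesian_Product.transpose (Y + \<epsilon> *\<^sub>R D) = Y + \<epsilon> *\<^sub>R D"
    using transpose_linear_combination[of 1 Y \<epsilon> D] D psd_transpose[OF assms(1)] by simp
  ultimately show thesis using that \<open>0 < \<epsilon>\<close> by (simp add: psd_def)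
qed

text \<open>The kernel is a hyperplane with some normal \<open>v\<close>, so the form depends on
  \<open>v \<bullet> x\<close> only.\<close>

lemma psd_rank_one:
  fixes X :: "real^'m^'m"
  assumes "psd X" "dim {x. X *v x = 0} + 1 = CARD('m)"
  obtains u where "\<And>x. x \<bullet> (X *v x) = (u \<bullet> x)\<^sup>2"
proof -
  have "dim {x. X *v x = 0} < DIM(real^'m)" using assms(2) by simp
  then obtain v where "v \<noteq> 0" and v: "span {x. X *v x = 0} \<subseteq> {x. v \<bullet> x = 0}"
    using lowdim_subset_hyperplane by blast
  have "{x. X *v x = 0} \<subseteq> {x. v \<bullet> x = 0}" by (rule subset_trans[OF real_vector.span_superset v])
  then have eq: "{x. X *v x = 0} = {x. v \<bullet> x = 0}"
    using assms(2) subspace_null_space subspace_hyperplane[of v] dim_hyperplane[OF \<open>v \<noteq> 0\<close>]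
    by (intro subspace_dim_equal) auto
  define c where "c = (v \<bullet> (X *v v)) / (v \<bullet> v)\<^sup>2"
  have "0 \<le> c" using psd_nonneg[OF assms(1)] by (simp add: c_def)
  have "x \<bullet> (X *v x) = ((sqrt c *\<^sub>R v) \<bullet> x)\<^sup>2" for x
  proof -
    \<comment> \<open>The coefficient of the orthogonal projection of \<open>x\<close> to the line
      of \<open>v\<close>.\<close>
    define t where "t = (v \<bullet> x) / (v \<bullet> v)"
    have "v \<bullet> (x - t *\<^sub>R v) = 0" using \<open>v \<noteq> 0\<close> by (simp add: t_def inner_diff_right)
    then have "X *v (x - t *\<^sub>R v) = 0" using eq by blast
    then have Xx: "X *v x = t *\<^sub>R (X *v v)"
      by (simp add: matrix_vector_mult_diff_distrib matrix_vector_mult_scaleR)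
    have "x \<bullet> (X *v x) = t * ((X *v x) \<bullet> v)"
      using Xx symmetric_matrix_inner[OF psd_transpose[OF assms(1)], of x v] by simp
    also have "\<dots> = t * t * (v \<bullet> (X *v v))" using Xx by (simp add: inner_commute)
    also have "\<dots> = c * (v \<bullet> x)\<^sup>2" by (simp add: t_def c_def power2_eq_square)
    finally show ?thesis using \<open>0 \<le> c\<close> by (simp add: power_mult_distrib)
  qed
  then show thesis by (rule that)
qed

section \<open>Strictly monotone functions on faces\<close>

text \<open>Descend from \<open>G\<close> to \<open>F\<close> by facets: each step lowers the
  dimension by exactly one and \<open>h\<close> by at least one.\<close>

lemma strict_mono_on_faces_aff_dim_le:
  fixes h :: "'a::euclidean_space set \<Rightarrow> nat"
  assumes "polytope P"
    and h: "\<And>F G. F face_of P \<Longrightarrow> G face_of P \<Longrightarrow> F \<noteq> {} \<Longrightarrow> F \<subset> G \<Longrightarrow> h F < h G"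
    and "F face_of P" "G face_of P" "F \<subseteq> G" "F \<noteq> {}"
  shows "int (h F) + (aff_dim G - aff_dim F) \<le> int (h G)"
  using assms(4,5)
proof (induction "nat (aff_dim G)" arbitrary: G rule: less_induct)
  case less
  show ?case
  proof (cases "F = G")
    case False
    have "polytope G" using assms(1) less.prems(1) face_of_polytope_polytope by blast
    moreover have "F face_of G"
      by (rule face_of_subset[OF assms(3) less.prems(2) face_of_imp_subset[OF less.prems(1)]])
    ultimately obtain G' where G': "G' facet_of G" "F \<subseteq> G'"
      using face_of_polyhedron_subset_facet[OF polytope_imp_polyhedron] False assms(6) by metis
    have f: "G' face_of G" "G' \<noteq> {}" "aff_dim G' = aff_dim G - 1"
      using G'(1) by (auto simp: facet_of_def)
    have "G' face_of P" using f(1) less.prems(1) face_of_trans by blast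
    \<comment> \<open>The induction measure is truncated by \<open>nat\<close>; this bound makes it
      decrease strictly.\<close>
    have "0 \<le> aff_dim G'" using f(2) aff_dim_geq[of G'] aff_dim_empty[of G'] by linarith
    then have "int (h F) + (aff_dim G' - aff_dim F) \<le> int (h G')"
      using less.hyps[of G'] f \<open>G' face_of P\<close> G'(2) by simp
    moreover have "h G' < h G"
      using h[OF \<open>G' face_of P\<close> less.prems(1) f(2)] f face_of_imp_subset by fastforce
    ultimately show ?thesis using f(3) by simp
  qed simp
qed

section \<open>Lifts of minimal size\<close>

text \<open>The size is fixed at one more than the dimension. Smaller lifts are also covered, after
  padding with zeros.\<close>

locale minimal_psd_lift =
  fixes P :: "'a::euclidean_space set" and L :: "(real^'m^'m) set" and \<pi> :: "real^'m^'m \<Rightarrow> 'a"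
  assumes polytope: "polytope P"
    and full_dim: "aff_dim P = int DIM('a)"
    and affine: "affine L"
    and symmetric: "\<And>Y. Y \<in> L \<Longrightarrow> Finite_Cartesian_Product.transpose Y = Y"
    and linear: "linear \<pi>"
    and lift: "P = \<pi> ` {Y \<in> L. psd Y}"
    and size: "CARD('m) = DIM('a) + 1"
begin

section \<open>Common kernels over faces\<close>

definition fiber :: "'a set \<Rightarrow> (real^'m^'m) set" where
  "fiber F = {Y \<in> L. psd Y \<and> \<pi> Y \<in> F}"

definition null :: "'a set \<Rightarrow> (real^'m) set" where
  "null F = {x. \<forall>Y\<in>fiber F. Y *v x = 0}"

lemma subspace_null: "Real_Vector_Spaces.subspace (null F)"
  by (auto simp: null_def real_vector.subspace_def matrix_vector_right_distrib
      matrix_vector_mult_scaleR)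

lemma null_antimono: "F \<subseteq> G \<Longrightarrow> null G \<subseteq> null F"
  by (auto simp: null_def fiber_def)

lemma convex_fiber:
  assumes "convex F"
  shows "convex (fiber F)"
proof (rule convexI)
  fix Y Z and u v :: real
  assume *: "Y \<in> fiber F" "Z \<in> fiber F" "0 \<le> u" "0 \<le> v" "u + v = 1"
  have "u *\<^sub>R Y + v *\<^sub>R Z \<in> L"
    using * by (intro mem_affine[OF affine]) (auto simp: fiber_def)
  moreover have "\<pi> (u *\<^sub>R Y + v *\<^sub>R Z) \<in> F"
    using * assms by (auto simp: fiber_def convex_def linear_add[OF linear] linear_cmul[OF linear])
  ultimately show "u *\<^sub>R Y + v *\<^sub>R Z \<in> fiber F"
    using * by (simp add: fiber_def psd_nonneg_combination)
qed

text \<open>Take a matrix with the smallest kernel. Its midpoint with any other matrix of the fiber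
  has the intersection of the two kernels as kernel, so minimality puts the smallest kernel inside
  every other one.\<close>

lemma ex_fiber_null:
  assumes "convex F" "fiber F \<noteq> {}"
  obtains Y where "Y \<in> fiber F" "{x. Y *v x = 0} = null F"
proof -
  obtain Y where Y: "Y \<in> fiber F" and
    min: "\<And>Z. Z \<in> fiber F \<Longrightarrow>
      dim {x. Y *v x = 0} \<le> dim {x. Z *v x = 0}"
    using ex_has_least_nat[of "\<lambda>Y. Y \<in> fiber F" _ "\<lambda>Y. dim {x. Y *v x = 0}"]
      assms(2) by blast
  have "Z *v x = 0" if "Z \<in> fiber F" "Y *v x = 0" for Z x
  proof (rule ccontr)
    assume "Z *v x \<noteq> 0"
    define W where "W = (1/2) *\<^sub>R Y + (1/2) *\<^sub>R Z"
    have "W \<in> fiber F"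
      using convexD[OF convex_fiber[OF assms(1)] Y that(1), of "1/2" "1/2"] by (simp add: W_def)
    have "Y *v x' = 0" "Z *v x' = 0" if "W *v x' = 0" for x'
      using psd_sum_null_vector[of Y Z "1/2" "1/2" x'] that Y \<open>Z \<in> fiber F\<close>
      by (auto simp: W_def fiber_def)
    then have "{x. W *v x = 0} \<subset> {x. Y *v x = 0}"
      using \<open>Z *v x \<noteq> 0\<close> \<open>Y *v x = 0\<close> by blast
    then have "dim {x. W *v x = 0} < dim {x. Y *v x = 0}"
      using dim_psubset subspace_null_space by (metis real_vector.span_eq_iff)
    then show False using min[OF \<open>W \<in> fiber F\<close>] by simp
  qed
  then have "{x. Y *v x = 0} = null F" using Y by (auto simp: null_def)
  with Y show thesis by (rule that)
qed

lemma fiber_nonempty: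
  assumes "F \<subseteq> P" "F \<noteq> {}"
  shows "fiber F \<noteq> {}"
  using assms lift by (auto simp: fiber_def)

lemma image_fiber: "F \<subseteq> P \<Longrightarrow> p \<in> F \<Longrightarrow> \<exists>Y\<in>fiber F. \<pi> Y = p"
  using lift by (auto simp: fiber_def)

lemma ex_null_face:
  assumes "F face_of P" "F \<noteq> {}"
  obtains Y where "Y \<in> fiber F" "{x. Y *v x = 0} = null F"
  using ex_fiber_null fiber_nonempty assms face_of_imp_subset face_of_imp_convex by metis

text \<open>If the kernels agreed, a matrix of maximal rank over \<open>F\<close> could be pushed slightly away from
  a point of \<open>G - F\<close> and remain positive semidefinite, so \<open>F\<close> would not be a face.\<close>

lemma dim_null_less:
  assumes "F face_of P" "G face_of P" "F \<noteq> {}" "F \<subset> G"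
  shows "dim (null G) < dim (null F)"
proof -
  have "null G \<noteq> null F"
  proof
    assume eq: "null G = null F"
    obtain Y where Y: "Y \<in> fiber F" "{x. Y *v x = 0} = null F"
      using ex_null_face assms(1,3) by blast
    have "G \<subseteq> P" using assms(2) by (rule face_of_imp_subset)
    obtain p where "p \<in> G" "p \<notin> F" using assms(4) by blast
    then obtain Z where Z: "Z \<in> fiber G" "\<pi> Z = p" using image_fiber[OF \<open>G \<subseteq> P\<close>] by blast
    have "Finite_Cartesian_Product.transpose (Y - Z) = Y - Z"
      using transpose_linear_combination[of 1 Y "-1" Z] Y(1) Z(1)
      by (simp add: fiber_def psd_transpose)
    \<comment> \<open>\<open>Y\<close> and \<open>Z\<close> both vanish on the kernel of
      \<open>Y\<close>, so both sides are 0 and the constant 1 is arbitrary.\<close>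
    moreover have "1 * (norm ((Y - Z) *v z))\<^sup>2 \<le> z \<bullet> ((Y - Z) *v z)" if "Y *v z = 0" for z
    proof -
      have "z \<in> null G" using that Y(2) eq by blast
      then have "Z *v z = 0" using Z(1) by (auto simp: null_def)
      then show ?thesis using that by (simp add: matrix_vector_mult_diff_rdistrib)
    qed
    ultimately obtain \<epsilon> where e: "0 < \<epsilon>" "psd (Y + \<epsilon> *\<^sub>R (Y - Z))"
      using psd_perturbation[of Y "Y - Z" 1] Y(1) by (auto simp: fiber_def)
    \<comment> \<open>A point of the line through \<open>Z\<close> and \<open>Y\<close> beyond
      \<open>Y\<close>, so that \<open>\<pi> Y\<close> lies strictly between \<open>\<pi> W\<close>
      and \<open>p\<close>.\<close>
    define W where "W = (1 + \<epsilon>) *\<^sub>R Y + (- \<epsilon>) *\<^sub>R Z"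
    have W_eq: "W = Y + \<epsilon> *\<^sub>R (Y - Z)" by (simp add: W_def algebra_simps)
    have "W \<in> L"
      unfolding W_def using Y(1) Z(1) by (intro mem_affine[OF affine]) (auto simp: fiber_def)
    then have "\<pi> W \<in> P" using e(2) lift W_eq by auto
    moreover have "p \<in> P" using \<open>p \<in> G\<close> \<open>G \<subseteq> P\<close> by blast
    moreover have "\<pi> Y \<in> F" using Y(1) by (simp add: fiber_def)
    moreover have "\<pi> Y \<in> open_segment (\<pi> W) p"
    proof -
      have pW: "\<pi> W = (1 + \<epsilon>) *\<^sub>R \<pi> Y - \<epsilon> *\<^sub>R p"
        using Z(2) by (simp add: W_def linear_diff[OF linear] linear_cmul[OF linear] linear_add[OF linear] linear_neg[OF linear])
      have ne: "\<pi> W \<noteq> p"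
      proof
        assume "\<pi> W = p"
        then have "(1 + \<epsilon>) *\<^sub>R \<pi> Y = (1 + \<epsilon>) *\<^sub>R p" by (simp add: pW algebra_simps)
        then have "\<pi> Y = p" using e(1) by (simp only: real_vector.scale_cancel_left) simp
        then show False using \<open>\<pi> Y \<in> F\<close> \<open>p \<notin> F\<close> by simp
      qed
      have "\<pi> Y = (1 - \<epsilon> / (1 + \<epsilon>)) *\<^sub>R \<pi> W + (\<epsilon> / (1 + \<epsilon>)) *\<^sub>R p"
      proof -
        have "1 - \<epsilon> / (1 + \<epsilon>) = 1 / (1 + \<epsilon>)" using e(1) by (simp add: field_simps)
        then show ?thesis using e(1) by (simp add: pW scaleR_diff_right)
      qed
      then show ?thesis using ne e(1) by (auto simp: in_segment intro!: exI[of _ "\<epsilon> / (1 + \<epsilon>)"])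
    qed
    ultimately have "p \<in> F" using assms(1) by (meson face_of_def)
    then show False using \<open>p \<notin> F\<close> by simp
  qed
  then have "null G \<subset> null F" using null_antimono assms(4) by blast
  then show ?thesis by (metis dim_psubset real_vector.span_eq_iff subspace_null)
qed

section \<open>Exact dimensions of the kernels\<close>

lemma dim_null_le: "dim (null F) \<le> CARD('m)"
  using dim_subset_UNIV[of "null F"] by simp

text \<open>Otherwise the zero matrix lies in \<open>L\<close>, so the lift and hence
  \<open>P\<close> are closed under nonnegative scaling. A bounded set of this kind is contained in
  \<open>{0}\<close>, but \<open>P\<close> has positive dimension.\<close>

lemma dim_null_point:
  assumes "p \<in> P"
  shows "dim (null {p}) < CARD('m)"
proof (rule ccontr)
  assume "\<not> ?thesis"
  then have "dim (null {p}) = DIM(real^'m)" using dim_null_le[of "{p}"] by simp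
  then have "null {p} = UNIV"
    using dim_eq_full real_vector.span_eq_iff subspace_null by metis
  obtain Y where Y: "Y \<in> fiber {p}" using fiber_nonempty[of "{p}"] assms by auto
  have "Y *v x = 0" for x using \<open>null {p} = UNIV\<close> Y by (auto simp: null_def)
  then have "Y = 0" by (metis matrix_eq matrix_vector_mult_0)
  then have "0 \<in> L" using Y by (simp add: fiber_def)
  have scale: "t *\<^sub>R q \<in> P" if "q \<in> P" "0 \<le> t" for t q
  proof -
    obtain Z where Z: "Z \<in> L" "psd Z" "\<pi> Z = q" using \<open>q \<in> P\<close> lift by auto
    have "(1 - t) *\<^sub>R 0 + t *\<^sub>R Z \<in> L"
      using \<open>0 \<in> L\<close> Z(1) by (intro mem_affine[OF affine]) auto
    moreover have "psd (t *\<^sub>R Z)" using psd_nonneg_combination[OF Z(2) Z(2) \<open>0 \<le> t\<close>, of 0] by simp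
    ultimately have "\<pi> (t *\<^sub>R Z) \<in> P" using lift by auto
    then show ?thesis using Z(3) by (simp add: linear_cmul[OF linear])
  qed
  have "q = 0" if "q \<in> P" for q
  proof (rule ccontr)
    assume "q \<noteq> 0"
    obtain B where B: "\<And>x. x \<in> P \<Longrightarrow> norm x \<le> B"
      using polytope_imp_bounded[OF polytope] bounded_iff by blast
    have "0 \<le> B" using B[OF that] norm_ge_zero order_trans by blast
    \<comment> \<open>The scaled point has norm \<open>B + 1\<close>.\<close>
    have "norm (((B + 1) / norm q) *\<^sub>R q) \<le> B"
      using \<open>0 \<le> B\<close> by (intro B scale that) auto
    then show False using \<open>q \<noteq> 0\<close> \<open>0 \<le> B\<close> by simp
  qed
  then have "P \<subseteq> {0}" by blast
  then have "aff_dim P \<le> 0" using aff_dim_subset[of P "{0}"] by simp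
  then show False using full_dim by (simp)
qed

text \<open>The codimension \<open>h\<close> of the kernel is at least 1 at a vertex and at most n +
  1 at \<open>P\<close>, while monotonicity along a flag already forces an increase of n. So every
  inequality on the way is an equality.\<close>

lemma dim_null_face:
  assumes F: "F face_of P" "F \<noteq> {}"
  shows "int (dim (null F)) = int DIM('a) - aff_dim F"
proof -
  define h where "h = (\<lambda>F. CARD('m) - dim (null F))"
  have h: "h F < h G" if "F face_of P" "G face_of P" "F \<noteq> {}" "F \<subset> G" for F G
    using dim_null_less[OF that] dim_null_le[of F] by (simp add: h_def)
  have "compact F" using F(1) polytope face_of_polytope_polytope polytope_imp_compact by blast
  then obtain p where "p extreme_point_of F"
    using extreme_point_exists_convex face_of_imp_convex F by metis
  then have p: "{p} face_of F" by (simp add: face_of_singleton)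
  then have "{p} face_of P" using F(1) face_of_trans by blast
  then have "p \<in> P" using face_of_imp_subset by blast
  have "P face_of P" using polytope polytope_imp_convex face_of_refl by blast
  have "int (h {p}) + (aff_dim F - aff_dim {p}) \<le> int (h F)"
    by (rule strict_mono_on_faces_aff_dim_le[OF polytope h \<open>{p} face_of P\<close> F(1) face_of_imp_subset[OF p]]) auto
  moreover have "int (h F) + (aff_dim P - aff_dim F) \<le> int (h P)"
    by (rule strict_mono_on_faces_aff_dim_le[OF polytope h F(1) \<open>P face_of P\<close> face_of_imp_subset[OF F(1)] F(2)])
  moreover have "1 \<le> h {p}" using dim_null_point[OF \<open>p \<in> P\<close>] by (simp add: h_def)
  moreover have "h P \<le> DIM('a) + 1" by (simp add: h_def size)
  ultimately have "int (h F) = aff_dim F + 1" using full_dim by simp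
  then show ?thesis using dim_null_le[of F] size by (simp add: h_def)
qed

section \<open>Matrices over the polytope, its vertices and its facets\<close>

lemma P_nonempty: "P \<noteq> {}"
  using full_dim by auto

text \<open>For the face \<open>P\<close> itself the dimension formula gives a trivial
  kernel.\<close>

lemma positive_definite_in_lift:
  obtains Y where "Y \<in> L" "psd Y" "\<And>x. Y *v x = 0 \<Longrightarrow> x = 0"
proof -
  have P: "P face_of P" using polytope polytope_imp_convex face_of_refl by blast
  have "dim (null P) = 0" using dim_null_face[OF P P_nonempty] full_dim by simp
  then have "null P \<subseteq> {0}" by simp
  obtain Y where Y: "Y \<in> fiber P" "{x. Y *v x = 0} = null P"
    using ex_null_face[OF P P_nonempty] by blast
  show thesis
  proof (rule that)
    show "Y \<in> L" "psd Y" using Y(1) by (auto simp: fiber_def)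
    show "x = 0" if "Y *v x = 0" for x using that Y(2) \<open>null P \<subseteq> {0}\<close> by blast
  qed
qed

text \<open>Over a vertex the kernel has codimension one.\<close>

lemma vertex_rank_one:
  assumes "p extreme_point_of P"
  obtains X u where "X \<in> L" "psd X" "\<pi> X = p" "\<And>x. x \<bullet> (X *v x) = (u \<bullet> x)\<^sup>2"
proof -
  have f: "{p} face_of P" using assms by (simp add: face_of_singleton)
  obtain X where X: "X \<in> fiber {p}" "{x. X *v x = 0} = null {p}"
    using ex_null_face[OF f] by blast
  moreover have "dim {x. X *v x = 0} + 1 = CARD('m)"
    using dim_null_face[OF f] X(2) size by simp
  ultimately obtain u where "\<And>x. x \<bullet> (X *v x) = (u \<bullet> x)\<^sup>2"
    using psd_rank_one[of X] by (auto simp: fiber_def)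
  with X(1) show thesis using that[of X u] by (auto simp: fiber_def)
qed

text \<open>The kernel over a facet is a line, spanned by \<open>w\<close>. Moving from a matrix of maximal rank over
  the facet in a direction on which \<open>Y \<mapsto> w \<bullet> Y w\<close> is positive stays in the cone, so the slack is
  nonnegative in that direction; hence the two functionals are proportional.\<close>

lemma facet_slack_eq_quadratic_form:
  assumes facet: "P \<inter> {x. a \<bullet> x = b} facet_of P" and valid: "P \<subseteq> {x. a \<bullet> x \<le> b}"
  obtains w where "\<And>Y. Y \<in> L \<Longrightarrow> b - a \<bullet> \<pi> Y = w \<bullet> (Y *v w)"
proof -
  define F where "F = P \<inter> {x. a \<bullet> x = b}"
  have F: "F face_of P" "F \<noteq> {}" "aff_dim F = aff_dim P - 1"
    using facet by (auto simp: F_def facet_of_def)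
  obtain Y where Y: "Y \<in> fiber F" and ker: "{x. Y *v x = 0} = null F" using ex_null_face F by blast
  have YL: "Y \<in> L" "psd Y" "a \<bullet> \<pi> Y = b" using Y by (auto simp: fiber_def F_def)
  have "dim (null F) = 1" using dim_null_face[OF F(1,2)] F(3) full_dim by simp
  moreover obtain B where B: "B \<subseteq> null F" "independent B" "null F \<subseteq> span B"
    "card B = dim (null F)"
    using basis_exists by blast
  ultimately obtain w where Bw: "B = {w}" by (metis card_1_singletonE)
  have w: "w \<noteq> 0" "null F = span {w}"
    using B(1-3) real_vector.span_minimal[OF B(1) subspace_null]
    by (auto simp: Bw real_vector.dependent_single)
  have Yw: "Y *v w = 0" using ker w(2) real_vector.span_base[of w "{w}"] by auto
  obtain R where R: "R \<in> L" "psd R" "\<And>x. R *v x = 0 \<Longrightarrow> x = 0" using positive_definite_in_lift by blast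
  define q where "q = (\<lambda>Z. w \<bullet> (Z *v w))"
  define s where "s = (\<lambda>Z. b - a \<bullet> \<pi> Z)"
  have "q R \<noteq> 0" using psd_null_vector[OF R(2), of w] R(3)[of w] w(1) by (auto simp: q_def)
  then have "0 < q R" using psd_nonneg[OF R(2), of w] by (simp add: q_def)
  have s_nonneg: "0 \<le> s Z" if "Z \<in> L" "psd Z" for Z
    using valid lift that by (auto simp: s_def)
  have eq: "s Z = q Z / q R * s R" if "Z \<in> L" for Z
  proof -
    define r where "r = q Z / q R"
    \<comment> \<open>An affine function of \<open>t\<close> that is nonnegative on the whole line
      has slope zero, which is the claimed proportionality.\<close>
    have "0 \<le> s R + t * (s Z - r * s R)" for t
    proof -
      \<comment> \<open>The correction \<open>t * r\<close> makes the value of the form at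
        \<open>w\<close> equal to \<open>q R\<close> for every \<open>t\<close>, so the direction is
        always admissible.\<close>
      define D where "D = (1 - t * r) *\<^sub>R (R - Y) + t *\<^sub>R (Z - Y)"
      have D: "Finite_Cartesian_Product.transpose D = D"
        using transpose_linear_combination[of 1 R "-1" Y] transpose_linear_combination[of 1 Z "-1" Y]
          symmetric[OF R(1)] symmetric[OF YL(1)] symmetric[OF \<open>Z \<in> L\<close>]
        by (simp add: D_def transpose_linear_combination)
      have qD: "w \<bullet> (D *v w) = q R"
      proof -
        have "w \<bullet> (D *v w) = (1 - t * r) * q R + t * q Z"
          using Yw by (simp add: D_def linear_combination_mult_vec q_def inner_add_right
              matrix_vector_mult_diff_rdistrib)
        then show ?thesis using \<open>q R \<noteq> 0\<close> by (simp add: r_def algebra_simps)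
      qed
      \<comment> \<open>The summand 1 covers the case \<open>D *v w = 0\<close>.\<close>
      define \<delta> where "\<delta> = q R / ((norm (D *v w))\<^sup>2 + 1)"
      have d1: "0 < (norm (D *v w))\<^sup>2 + 1" by (simp add: add_nonneg_pos)
      have "0 < \<delta>" using d1 \<open>0 < q R\<close> by (simp add: \<delta>_def)
      have d: "\<delta> * (norm (D *v w))\<^sup>2 \<le> q R"
        using d1 \<open>0 < q R\<close> by (simp add: \<delta>_def field_simps)
      have "\<delta> * (norm (D *v z))\<^sup>2 \<le> z \<bullet> (D *v z)" if "Y *v z = 0" for z
      proof -
        have "z \<in> range (\<lambda>k. k *\<^sub>R w)"
          using that ker w(2) real_vector.span_singleton[of w] by blast
        then obtain k where k: "z = k *\<^sub>R w" by blast
        have "\<delta> * (norm (D *v z))\<^sup>2 = k\<^sup>2 * (\<delta> * (norm (D *v w))\<^sup>2)"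
          by (simp add: k matrix_vector_mult_scaleR power_mult_distrib)
        also have "\<dots> \<le> k\<^sup>2 * q R" using d by (intro mult_left_mono) auto
        also have "\<dots> = z \<bullet> (D *v z)"
          by (simp add: k matrix_vector_mult_scaleR qD power2_eq_square)
        finally show ?thesis .
      qed
      then obtain \<epsilon> where e: "0 < \<epsilon>" "psd (Y + \<epsilon> *\<^sub>R D)"
        using psd_perturbation[OF YL(2) D \<open>0 < \<delta>\<close>] by blast
      define \<alpha> \<beta> where "\<alpha> = \<epsilon> * (1 - t * r)" and "\<beta> = \<epsilon> * t"
      have eqW: "Y + \<epsilon> *\<^sub>R D = (1 - \<alpha> - \<beta>) *\<^sub>R Y + \<alpha> *\<^sub>R R + \<beta> *\<^sub>R Z"
        by (simp add: D_def \<alpha>_def \<beta>_def algebra_simps)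
      have "Y + \<epsilon> *\<^sub>R D \<in> L"
        unfolding eqW by (rule mem_affine_3[OF affine YL(1) R(1) \<open>Z \<in> L\<close>]) simp
      then have "0 \<le> s (Y + \<epsilon> *\<^sub>R D)" using e(2) by (rule s_nonneg)
      also have "s (Y + \<epsilon> *\<^sub>R D) = (1 - \<alpha> - \<beta>) * s Y + \<alpha> * s R + \<beta> * s Z"
        unfolding eqW by (simp add: s_def linear_add[OF linear] linear_cmul[OF linear] inner_add_right)
          (simp add: algebra_simps)
      also have "\<dots> = \<epsilon> * (s R + t * (s Z - r * s R))"
        using YL(3) by (simp add: s_def \<alpha>_def \<beta>_def algebra_simps)
      finally show ?thesis using e(1) by (simp add: zero_le_mult_iff)
    qed
    then have "s Z - r * s R = 0" by (rule linear_in_parameter_zero)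
    then show ?thesis by (simp add: r_def)
  qed
  \<comment> \<open>The nonnegative factor of proportionality, absorbed into \<open>w\<close>
    through its square root.\<close>
  define c where "c = s R / q R"
  have "0 \<le> c" using s_nonneg[OF R(1,2)] \<open>0 < q R\<close> by (simp add: c_def)
  have "b - a \<bullet> \<pi> Z = (sqrt c *\<^sub>R w) \<bullet> (Z *v (sqrt c *\<^sub>R w))" if "Z \<in> L" for Z
  proof -
    have "b - a \<bullet> \<pi> Z = (sqrt c * sqrt c) * (w \<bullet> (Z *v w))"
      unfolding real_sqrt_mult_self abs_of_nonneg[OF \<open>0 \<le> c\<close>]
      using eq[OF that] by (simp add: s_def q_def c_def)
    then show ?thesis by (simp add: matrix_vector_mult_scaleR)
  qed
  then show thesis by (rule that)
qed

end

section \<open>Slacks of a full-dimensional polytope\<close>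

text \<open>\<open>facet_of_polyhedron_explicit\<close> speaks of a minimal set of half-spaces, the
  representation of an indexed family. Irredundancy supplies the bridge: equal half-spaces or a zero
  normal would allow an inequality to be dropped.\<close>

lemma irredundant_rep_facet_iff:
  fixes P :: "'a::euclidean_space set"
  assumes rep: "irredundant_rep P f a b" and "P \<noteq> {}" "aff_dim P = int DIM('a)"
  shows "G facet_of P \<longleftrightarrow> (\<exists>j<f. G = P \<inter> {x. a j \<bullet> x = b j})"
proof -
  define H where "H = (\<lambda>j. {x. a j \<bullet> x \<le> b j})"
  have P_eq: "P = (\<Inter>j<f. H j)"
    using rep by (auto simp: irredundant_rep_def H_def)
  have needed: "\<exists>x. x \<notin> P \<and> (\<forall>j<f. j \<noteq> i \<longrightarrow> x \<in> H j)" if "i < f" for i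
  proof -
    have "P \<noteq> {x. \<forall>j<f. j \<noteq> i \<longrightarrow> b j - a j \<bullet> x \<ge> 0}"
      using rep that by (auto simp: irredundant_rep_def)
    moreover have "P \<subseteq> {x. \<forall>j<f. j \<noteq> i \<longrightarrow> b j - a j \<bullet> x \<ge> 0}"
      by (auto simp: P_eq H_def)
    ultimately show ?thesis by (auto simp: H_def)
  qed
  have inj: "inj_on H {..<f}"
  proof (rule inj_onI, rule ccontr)
    fix i j assume *: "i \<in> {..<f}" "j \<in> {..<f}" "H i = H j" "i \<noteq> j"
    obtain x where "x \<notin> P" "\<forall>l<f. l \<noteq> i \<longrightarrow> x \<in> H l" using needed[of i] *(1) by auto
    moreover from this have "x \<in> H i" using * by auto
    ultimately show False by (auto simp: P_eq)
  qed
  have nonzero: "a j \<noteq> 0" if "j < f" for j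
  proof
    assume "a j = 0"
    obtain z where "z \<in> P" using \<open>P \<noteq> {}\<close> by blast
    then have "z \<in> H j" using that by (auto simp: P_eq)
    then have "0 \<le> b j" using \<open>a j = 0\<close> by (auto simp: H_def split: if_splits)
    then have "H j = UNIV" using \<open>a j = 0\<close> by (simp add: H_def)
    obtain x where "x \<notin> P" "\<forall>l<f. l \<noteq> j \<longrightarrow> x \<in> H l" using needed[OF \<open>j < f\<close>] by auto
    then show False using \<open>H j = UNIV\<close> by (auto simp: P_eq)
  qed
  \<comment> \<open>Recovers the index of a half-space.\<close>
  define g where "g = the_inv_into {..<f} H"
  have g: "g (H j) = j" if "j < f" for j
    using the_inv_into_f_f[OF inj] that by (simp add: g_def)
  have hull: "affine hull P = UNIV" using assms(3) aff_dim_eq_full by blast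
  have "G facet_of P \<longleftrightarrow> (\<exists>h. h \<in> H ` {..<f} \<and> G = P \<inter> {x. a (g h) \<bullet> x = b (g h)})"
  proof (rule facet_of_polyhedron_explicit)
    show "finite (H ` {..<f})" by simp
    show "P = affine hull P \<inter> \<Inter> (H ` {..<f})" using hull P_eq by simp
    show "a (g h) \<noteq> 0 \<and> h = {x. a (g h) \<bullet> x \<le> b (g h)}" if "h \<in> H ` {..<f}" for h
      using that nonzero g by (auto simp: H_def)
    show "P \<subset> affine hull P \<inter> \<Inter> F'" if F': "F' \<subset> H ` {..<f}" for F'
    proof -
      obtain i where i: "i < f" "H i \<notin> F'" using F' by blast
      obtain x where x: "x \<notin> P" "\<forall>j<f. j \<noteq> i \<longrightarrow> x \<in> H j" using needed[OF i(1)] by auto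
      have "x \<in> h" if "h \<in> F'" for h
      proof -
        obtain j where "j < f" "h = H j" using F' \<open>h \<in> F'\<close> by blast
        then show ?thesis using x(2) i(2) that by auto
      qed
      moreover have "P \<subseteq> \<Inter> F'" using F' P_eq by blast
      ultimately show ?thesis using x(1) hull by auto
    qed
  qed
  also have "\<dots> \<longleftrightarrow> (\<exists>j<f. G = P \<inter> {x. a j \<bullet> x = b j})"
    using g by auto
  finally show ?thesis .
qed

locale full_dim_slack =
  fixes P :: "'a::euclidean_space set" and f :: nat and a :: "nat \<Rightarrow> 'a" and b :: "nat \<Rightarrow> real"
    and v :: nat and p :: "nat \<Rightarrow> 'a"
  assumes polytope: "polytope P"
    and full_dim: "aff_dim P = int DIM('a)"
    and rep: "irredundant_rep P f a b"
    and vertices: "bij_betw p {..<v} {x. x extreme_point_of P}"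
begin

lemma P_nonempty: "P \<noteq> {}"
  using full_dim by auto

lemma P_iff: "x \<in> P \<longleftrightarrow> (\<forall>j<f. a j \<bullet> x \<le> b j)"
  using rep by (auto simp: irredundant_rep_def)

lemma vertex_in_P: "i < v \<Longrightarrow> p i \<in> P"
  using vertices by (auto simp: bij_betw_def extreme_point_of_def)

lemma facet_iff: "G facet_of P \<longleftrightarrow> (\<exists>j<f. G = P \<inter> {x. a j \<bullet> x = b j})"
  using irredundant_rep_facet_iff[OF rep P_nonempty full_dim] .

text \<open>A proper nonempty face is the intersection of the facets containing it, so one of these
  misses \<open>x\<close>.\<close>

lemma face_separation:
  assumes "F face_of P" "F \<noteq> {}" "x \<in> P" "x \<notin> F"
  obtains j where "j < f" "\<And>y. y \<in> F \<Longrightarrow> a j \<bullet> y = b j" "a j \<bullet> x \<noteq> b j"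
proof -
  have "F = \<Inter>{G. G facet_of P \<and> F \<subseteq> G}"
    using assms by (intro face_of_polyhedron[OF polytope_imp_polyhedron[OF polytope]]) auto
  then obtain G where G: "G facet_of P" "F \<subseteq> G" "x \<notin> G" using assms(4) by blast
  then obtain j where "j < f" "G = P \<inter> {x. a j \<bullet> x = b j}" using facet_iff by blast
  then show thesis using that[of j] G assms(3) by blast
qed

text \<open>A nonzero \<open>d\<close> would span a ray inside the bounded set
  \<open>P\<close>.\<close>

lemma recession_cone_trivial:
  assumes "\<And>j. j < f \<Longrightarrow> a j \<bullet> d \<le> 0"
  shows "d = 0"
proof (rule ccontr)
  assume "d \<noteq> 0"
  obtain z where z: "z \<in> P" using P_nonempty by blast
  obtain B where B: "\<And>x. x \<in> P \<Longrightarrow> norm x \<le> B"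
    using polytope_imp_bounded[OF polytope] bounded_iff by blast
  have ray: "z + s *\<^sub>R d \<in> P" if "0 \<le> s" for s
    unfolding P_iff
  proof (intro allI impI)
    fix j assume j: "j < f"
    have "s * (a j \<bullet> d) \<le> 0" using assms[OF j] that by (simp add: mult_nonneg_nonpos)
    then show "a j \<bullet> (z + s *\<^sub>R d) \<le> b j" using z j by (auto simp: P_iff inner_add_right)
  qed
  \<comment> \<open>Makes the norm of \<open>s *\<^sub>R d\<close> equal to
    \<open>B + norm z + 1\<close>, beyond what the triangle inequality allows.\<close>
  define s where "s = (B + norm z + 1) / norm d"
  have "0 \<le> B" using B[OF z] norm_ge_zero order_trans by blast
  then have "0 \<le> s" by (simp add: s_def)
  have "norm (s *\<^sub>R d) \<le> norm (z + s *\<^sub>R d) + norm z"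
    using norm_triangle_ineq4[of "z + s *\<^sub>R d" z] by simp
  also have "\<dots> \<le> B + norm z" using B[OF ray[OF \<open>0 \<le> s\<close>]] by simp
  finally show False using \<open>d \<noteq> 0\<close> \<open>0 \<le> B\<close> by (simp add: s_def)
qed

text \<open>Triviality of the kernel of the homogenized slack map. For \<open>t = 0\<close> the
  vector \<open>x\<close> is a recession direction. Otherwise all slacks vanish at
  \<open>x /\<^sub>R t\<close>, every point of \<open>P\<close> differs from it by a recession
  direction, and \<open>P\<close> is a single point.\<close>

lemma slack_map_injective:
  assumes "\<And>j. j < f \<Longrightarrow> a j \<bullet> x = t * b j"
  shows "t = 0 \<and> x = 0"
proof (cases "t = 0")
  case True
  then show ?thesis using recession_cone_trivial[of x] assms by simp
next
  case False
  define y where "y = x /\<^sub>R t"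
  have y: "a j \<bullet> y = b j" if "j < f" for j
    using assms[OF that] False by (simp add: y_def)
  have "q - y = 0" if "q \<in> P" for q
    using that y by (intro recession_cone_trivial) (auto simp: P_iff inner_diff_right)
  then have "P \<subseteq> {y}" by auto
  then have "aff_dim P \<le> 0" using aff_dim_subset[of P "{y}"] by simp
  then show ?thesis using full_dim by simp
qed

text \<open>Dually to injectivity, the vectors \<open>(b j, - a j)\<close> span the whole space, and
  pairing them with \<open>(1, x)\<close> gives the slacks. The formula has no constant term, which
  makes the projection of the lift linear and not just affine.\<close>

lemma recover_point_from_slacks:
  obtains c where "\<And>x. x = (\<Sum>j<f. (b j - a j \<bullet> x) *\<^sub>R c j)"
proof -
  define g where "g = (\<lambda>j. (b j, - a j))"
  have full: "span (g ` {..<f}) = UNIV"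
  proof (rule ccontr)
    assume "\<not> ?thesis"
    then obtain y where y: "y \<noteq> 0" "span (g ` {..<f}) \<subseteq> {x. y \<bullet> x = 0}"
      using span_not_univ_subset_hyperplane by metis
    have "y \<bullet> g j = 0" if "j < f" for j
      using y(2) real_vector.span_base[of "g j" "g ` {..<f}"] that by auto
    then have "fst y = 0 \<and> snd y = 0"
      by (intro slack_map_injective) (auto simp: g_def inner_prod_def inner_commute)
    then show False using y(1) by (simp add: prod_eq_iff)
  qed
  have "\<exists>C. y = (\<Sum>j<f. C j *\<^sub>R g j)" for y
  proof -
    \<comment> \<open>The span with coefficients indexed by \<open>j\<close>, so repeated values of
      \<open>g\<close> need no care.\<close>
    define V where "V = {y. \<exists>C. y = (\<Sum>j<f. C j *\<^sub>R g j)}"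
    have "Real_Vector_Spaces.subspace V"
      unfolding real_vector.subspace_def
    proof (intro conjI ballI allI)
      show "0 \<in> V" unfolding V_def by (auto intro: exI[of _ "\<lambda>_. 0"])
      show "x + y \<in> V" if "x \<in> V" "y \<in> V" for x y
      proof -
        obtain C D where "x = (\<Sum>j<f. C j *\<^sub>R g j)" "y = (\<Sum>j<f. D j *\<^sub>R g j)"
          using \<open>x \<in> V\<close> \<open>y \<in> V\<close> unfolding V_def by blast
        then have "x + y = (\<Sum>j<f. (C j + D j) *\<^sub>R g j)"
          by (simp add: scaleR_add_left sum.distrib)
        then show ?thesis unfolding V_def by (intro CollectI exI)
      qed
      show "k *\<^sub>R x \<in> V" if "x \<in> V" for k x
      proof -
        obtain C where "x = (\<Sum>j<f. C j *\<^sub>R g j)" using \<open>x \<in> V\<close> unfolding V_def by blast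
        then have "k *\<^sub>R x = (\<Sum>j<f. (k * C j) *\<^sub>R g j)" by (simp add: scaleR_sum_right)
        then show ?thesis unfolding V_def by (intro CollectI exI)
      qed
    qed
    moreover have "g ` {..<f} \<subseteq> V"
    proof (rule image_subsetI)
      fix l assume "l \<in> {..<f}"
      then have "g l = (\<Sum>j<f. (if j = l then 1 else 0) *\<^sub>R g j)"
        by (simp add: if_distrib[of "\<lambda>k. k *\<^sub>R _"] cong: if_cong)
      then show "g l \<in> V" unfolding V_def by (intro CollectI exI)
    qed
    ultimately have "span (g ` {..<f}) \<subseteq> V" by (rule real_vector.span_minimal[rotated])
    then show ?thesis using full by (auto simp: V_def)
  qed
  then obtain C where C: "\<And>y. y = (\<Sum>j<f. C y j *\<^sub>R g j)" by metis
  \<comment> \<open>Expanding \<open>(0, i)\<close> yields the coordinate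
    \<open>x \<bullet> i\<close>; the first component 0 removes the constant.\<close>
  define c where "c = (\<lambda>j. \<Sum>i\<in>Basis. C (0, i) j *\<^sub>R i)"
  have "x = (\<Sum>j<f. (b j - a j \<bullet> x) *\<^sub>R c j)" for x
  proof -
    have "x \<bullet> i = (\<Sum>j<f. C (0, i) j * (b j - a j \<bullet> x))" for i
    proof -
      have "x \<bullet> i = (1::real, x) \<bullet> (0, i)" by (simp add: inner_prod_def)
      also have "\<dots> = (1::real, x) \<bullet> (\<Sum>j<f. C (0, i) j *\<^sub>R g j)" using C[of "(0, i)"] by simp
      also have "\<dots> = (\<Sum>j<f. C (0, i) j * ((1, x) \<bullet> g j))"
        by (simp add: inner_sum_right)
      also have "\<dots> = (\<Sum>j<f. C (0, i) j * (b j - a j \<bullet> x))"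
        by (simp add: g_def inner_prod_def inner_commute)
      finally show ?thesis .
    qed
    then have "x = (\<Sum>i\<in>Basis. (\<Sum>j<f. C (0, i) j * (b j - a j \<bullet> x)) *\<^sub>R i)"
      using euclidean_representation[of x] by simp
    also have "\<dots> = (\<Sum>j<f. (b j - a j \<bullet> x) *\<^sub>R c j)"
      unfolding c_def scaleR_sum_left scaleR_sum_right
      by (subst sum.swap) (simp add: mult.commute)
    finally show ?thesis .
  qed
  then show thesis by (rule that)
qed

lemma P_eq_convex_hull: "P = convex hull (p ` {..<v})"
proof -
  have "P = convex hull {x. x extreme_point_of P}"
    by (rule Krein_Milman_Minkowski[OF polytope_imp_compact polytope_imp_convex]) (rule polytope)+
  then show ?thesis using vertices by (simp add: bij_betw_def)
qed

text \<open>Along a flag of faces the span of the vectors \<open>u i\<close> of the vertices grows at every step: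
  some \<open>w j\<close> annihilates the smaller face but not a new vertex.\<close>

lemma zero_pattern_not_realizable:
  fixes u w :: "nat \<Rightarrow> 'a"
  assumes pattern: "\<And>i j. i < v \<Longrightarrow> j < f \<Longrightarrow> u i \<bullet> w j = 0 \<longleftrightarrow> a j \<bullet> p i = b j"
  shows False
proof -
  define C where "C = (\<lambda>F. span (u ` {i. i < v \<and> p i \<in> F}))"
  define h where "h = (\<lambda>F. dim (C F))"
  have h: "h F < h G" if FG: "F face_of P" "G face_of P" "F \<noteq> {}" "F \<subset> G" for F G
  proof -
    have "polytope G" using face_of_polytope_polytope[OF polytope \<open>G face_of P\<close>] .
    then have "G = convex hull {x. x extreme_point_of G}"
      by (intro Krein_Milman_Minkowski polytope_imp_compact polytope_imp_convex)
    moreover have "convex F" using face_of_imp_convex FG(1) .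
    ultimately have "\<not> {x. x extreme_point_of G} \<subseteq> F"
      using hull_minimal[of _ F convex] FG(4) by (metis less_le_not_le)
    then obtain x where x: "x extreme_point_of G" "x \<notin> F" by blast
    then have "x extreme_point_of P" "x \<in> G"
      using FG(2) extreme_point_of_face by blast+
    then obtain i where i: "i < v" "x = p i"
      using vertices by (auto simp: bij_betw_def)
    obtain j where j: "j < f" "\<And>y. y \<in> F \<Longrightarrow> a j \<bullet> y = b j" "a j \<bullet> x \<noteq> b j"
      using face_separation[OF FG(1,3)] x(2) \<open>x extreme_point_of P\<close> extreme_point_of_def by metis
    have "u ` {i. i < v \<and> p i \<in> F} \<subseteq> {y. w j \<bullet> y = 0}"
      using j(1,2) pattern by (auto simp: inner_commute[of "w j"])
    then have "C F \<subseteq> {y. w j \<bullet> y = 0}"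
      unfolding C_def by (rule real_vector.span_minimal[OF _ subspace_hyperplane])
    moreover have "u i \<bullet> w j \<noteq> 0" using pattern[OF i(1) j(1)] j(3) i(2) by simp
    ultimately have "u i \<notin> C F" by (auto simp: inner_commute[of "w j"])
    moreover have "u i \<in> C G"
      unfolding C_def using i \<open>x \<in> G\<close> by (intro real_vector.span_base) auto
    moreover have "C F \<subseteq> C G" unfolding C_def using FG(4) by (intro real_vector.span_mono) auto
    ultimately have "C F \<subset> C G" by blast
    then show ?thesis unfolding h_def C_def
      by (intro dim_psubset) (simp only: real_vector.span_span)
  qed
  obtain x where x: "x extreme_point_of P"
    using extreme_point_exists_convex[OF polytope_imp_compact polytope_imp_convex P_nonempty] polytope
    by blast
  then obtain i where i: "i < v" "x = p i"
    using vertices by (auto simp: bij_betw_def)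
  have fx: "{x} face_of P" using x by (simp add: face_of_singleton)
  have "P face_of P" using polytope_imp_convex[OF polytope] by (rule face_of_refl)
  \<comment> \<open>Not all slacks of a vertex vanish, so its vector is nonzero and \<open>h\<close>
    starts at 1 or more. The n increases then exceed the dimension of the space.\<close>
  have "\<exists>j<f. a j \<bullet> x \<noteq> 1 * b j" using slack_map_injective[of x 1] by auto
  then obtain j where "j < f" "u i \<bullet> w j \<noteq> 0" using pattern i by auto
  then have "u i \<noteq> 0" by auto
  moreover have "u i \<in> C {x}" unfolding C_def using i by (intro real_vector.span_base) auto
  ultimately have "\<not> C {x} \<subseteq> {0}" by blast
  then have "h {x} \<noteq> 0" unfolding h_def using dim_eq_0[of "C {x}"] by blast
  moreover have "int (h {x}) + (aff_dim P - aff_dim {x}) \<le> int (h P)"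
    using face_of_imp_subset[OF fx]
    by (intro strict_mono_on_faces_aff_dim_le[OF polytope h fx \<open>P face_of P\<close>]) auto
  moreover have "h P \<le> DIM('a)" unfolding h_def by (rule dim_subset_UNIV)
  ultimately show False using full_dim by simp
qed

end

section \<open>Lifts from square factorizations\<close>

text \<open>The argument is a plain function, of which only the values below \<open>k\<close> count;
  this avoids carriers for vectors.\<close>

definition quad_form :: "nat \<Rightarrow> real mat \<Rightarrow> (nat \<Rightarrow> real) \<Rightarrow> real" where
  "quad_form k Y x = (\<Sum>l<k. \<Sum>r<k. x l * Y $$ (l, r) * x r)"

lemma scalar_prod_mult_mat_vec:
  assumes "Y \<in> carrier_mat k k" "x \<in> carrier_vec k"
  shows "scalar_prod x (Y *\<^sub>v x) = quad_form k Y (vec_index x)"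
  using assms
  by (auto simp: quad_form_def scalar_prod_def sum_distrib_left mult.assoc atLeast0LessThan
      intro!: sum.cong)

lemma psd_cone_iff: "Y \<in> psd_cone k \<longleftrightarrow> Y \<in> sym_mats k \<and> (\<forall>x. 0 \<le> quad_form k Y x)"
proof -
  have "quad_form k Y x = quad_form k Y (vec_index (Matrix.vec k x))" for x
    unfolding quad_form_def by (intro sum.cong) auto
  then have "(\<forall>x\<in>carrier_vec k. 0 \<le> quad_form k Y (vec_index x)) \<longleftrightarrow> (\<forall>x. 0 \<le> quad_form k Y x)"
    by (metis vec_carrier)
  then show ?thesis
    by (auto simp: psd_cone_def sym_mats_def scalar_prod_mult_mat_vec)
qed

lemma quad_form_add:
  assumes "Y \<in> carrier_mat k k" "Z \<in> carrier_mat k k"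
  shows "quad_form k (Y + Z) x = quad_form k Y x + quad_form k Z x"
  using assms by (simp add: quad_form_def distrib_left distrib_right sum.distrib)

lemma quad_form_smult:
  assumes "Y \<in> carrier_mat k k"
  shows "quad_form k (c \<cdot>\<^sub>m Y) x = c * quad_form k Y x"
  using assms by (simp add: quad_form_def sum_distrib_left mult.assoc mult.left_commute[of c])

lemma sym_mats_linear_combination:
  assumes "Y \<in> sym_mats k" "Z \<in> sym_mats k"
  shows "u \<cdot>\<^sub>m Y + v \<cdot>\<^sub>m Z \<in> sym_mats k"
proof -
  have "Y $$ (l, r) = Y $$ (r, l)" "Z $$ (l, r) = Z $$ (r, l)" if "l < k" "r < k" for l r
    using assms that unfolding sym_mats_def mem_Collect_eq
    by (metis carrier_matD index_transpose_mat(1))+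
  then show ?thesis using assms by (auto simp: sym_mats_def)
qed

section \<open>Inner products and numerically indexed factorizations\<close>

lemma inner_eq_sum_enum_Basis:
  fixes x y :: "'e::euclidean_space"
  assumes "bij_betw e {..<DIM('e)} Basis"
  shows "x \<bullet> y = (\<Sum>l<DIM('e). (x \<bullet> e l) * (y \<bullet> e l))"
  unfolding euclidean_inner[of x y] by (rule sum.reindex_bij_betw[OF assms, symmetric])

lemma inner_as_sum:
  fixes u w :: "nat \<Rightarrow> 'e::euclidean_space"
  obtains U W where "\<And>i j. u i \<bullet> w j = (\<Sum>l<DIM('e). U i l * W l j)"
proof -
  obtain e where "bij_betw e {..<DIM('e)} (Basis :: 'e set)"
    using ex_bij_betw_nat_finite[OF finite_Basis] by (auto simp: atLeast0LessThan)
  then show thesis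
    using that[of "\<lambda>i l. u i \<bullet> e l" "\<lambda>l j. w j \<bullet> e l"] inner_eq_sum_enum_Basis by blast
qed

text \<open>The factors become coordinates with respect to \<open>k\<close> distinct orthonormal
  basis vectors.\<close>

lemma sum_as_inner:
  fixes U W :: "nat \<Rightarrow> nat \<Rightarrow> real"
  assumes "k \<le> DIM('e)"
  obtains u w :: "nat \<Rightarrow> 'e::euclidean_space" where "\<forall>i j. u i \<bullet> w j = (\<Sum>l<k. U i l * W l j)"
proof -
  obtain e where e: "bij_betw e {..<DIM('e)} (Basis :: 'e set)"
    using ex_bij_betw_nat_finite[OF finite_Basis] by (auto simp: atLeast0LessThan)
  have "e l \<bullet> e r = (if l = r then 1 else 0)" if "l < k" "r < k" for l r
  proof -
    have "l \<in> {..<DIM('e)}" "r \<in> {..<DIM('e)}" using that assms by auto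
    then have "e l \<in> Basis" "e r \<in> Basis" "e l = e r \<longleftrightarrow> l = r"
      using e by (auto simp: bij_betw_def inj_on_def)
    then show ?thesis by (simp add: inner_Basis)
  qed
  note ortho = this
  have "(\<Sum>l<k. U i l *\<^sub>R e l) \<bullet> (\<Sum>r<k. W r j *\<^sub>R e r) = (\<Sum>l<k. U i l * W l j)" for i j
  proof -
    have "(\<Sum>l<k. U i l *\<^sub>R e l) \<bullet> (\<Sum>r<k. W r j *\<^sub>R e r) =
        (\<Sum>l<k. \<Sum>r<k. U i l * (W r j * (e l \<bullet> e r)))"
      unfolding inner_sum_left by (simp add: inner_sum_right sum_distrib_left mult.left_commute)
    also have "\<dots> = (\<Sum>l<k. \<Sum>r<k. if l = r then U i l * W r j else 0)"
      using ortho by (intro sum.cong) auto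
    finally show ?thesis by simp
  qed
  then show thesis by (intro that allI)
qed

context full_dim_slack
begin

text \<open>A psd matrix of \<open>L\<close> has nonnegative slacks, hence lies over a point of
  \<open>P\<close>. Conversely, a convex combination of vertices is the image of the same
  combination of the rank-one matrices of the rows of \<open>U\<close>.\<close>

lemma has_psd_lift_of_square_factorization:
  assumes fac: "\<And>i j. i < v \<Longrightarrow> j < f \<Longrightarrow> (\<Sum>l<k. U i l * W l j)\<^sup>2 = b j - a j \<bullet> p i"
  shows "has_psd_lift k P"
proof -
  obtain c where c: "\<And>x. x = (\<Sum>j<f. (b j - a j \<bullet> x) *\<^sub>R c j)"
    using recover_point_from_slacks by blast
  define q where "q = (\<lambda>j Y. quad_form k Y (\<lambda>l. W l j))"
  define L where "L = {Y \<in> sym_mats k. \<exists>x. \<forall>j<f. q j Y = b j - a j \<bullet> x}"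
  \<comment> \<open>Reads the point off its slacks.\<close>
  define \<pi> where "\<pi> = (\<lambda>Y. \<Sum>j<f. q j Y *\<^sub>R c j)"
  have q_add: "q j (Y + Z) = q j Y + q j Z" if "Y \<in> carrier_mat k k" "Z \<in> carrier_mat k k" for j Y Z
    unfolding q_def using that by (rule quad_form_add)
  have q_smult: "q j (t \<cdot>\<^sub>m Y) = t * q j Y" if "Y \<in> carrier_mat k k" for j Y t
    unfolding q_def using that by (rule quad_form_smult)
  have carrier: "Y \<in> carrier_mat k k" if "Y \<in> sym_mats k" for Y
    using that by (simp add: sym_mats_def)
  have "affine_in_sym k L"
    unfolding affine_in_sym_def
  proof (intro conjI ballI allI impI)
    fix Y Z and s t :: real
    assume YZ: "Y \<in> L" "Z \<in> L" "s + t = 1"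
    then obtain x y where x: "\<forall>j<f. q j Y = b j - a j \<bullet> x" and y: "\<forall>j<f. q j Z = b j - a j \<bullet> y"
      by (auto simp: L_def)
    have "q j (s \<cdot>\<^sub>m Y + t \<cdot>\<^sub>m Z) = b j - a j \<bullet> (s *\<^sub>R x + t *\<^sub>R y)" if "j < f" for j
    proof -
      have "q j (s \<cdot>\<^sub>m Y + t \<cdot>\<^sub>m Z) = s * q j Y + t * q j Z"
        using YZ(1,2) carrier by (simp add: L_def q_add q_smult)
      also have "\<dots> = s * (b j - a j \<bullet> x) + t * (b j - a j \<bullet> y)"
        using x y that by simp
      also have "\<dots> = (s + t) * b j - a j \<bullet> (s *\<^sub>R x + t *\<^sub>R y)"
        by (simp add: inner_add_right algebra_simps)
      finally show ?thesis using YZ(3) by simp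
    qed
    then show "s \<cdot>\<^sub>m Y + t \<cdot>\<^sub>m Z \<in> L"
      using YZ sym_mats_linear_combination unfolding L_def by blast
  qed (auto simp: L_def)
  moreover have "linear_on_sym k \<pi>"
    unfolding linear_on_sym_def \<pi>_def
    using carrier by (simp add: q_add q_smult scaleR_add_left sum.distrib scaleR_sum_right)
  moreover have "\<pi> ` (psd_cone k \<inter> L) = P"
  proof
    show "\<pi> ` (psd_cone k \<inter> L) \<subseteq> P"
    proof (rule image_subsetI)
      fix Y assume Y: "Y \<in> psd_cone k \<inter> L"
      then obtain x where x: "\<forall>j<f. q j Y = b j - a j \<bullet> x" by (auto simp: L_def)
      have "\<pi> Y = (\<Sum>j<f. (b j - a j \<bullet> x) *\<^sub>R c j)" using x by (simp add: \<pi>_def)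
      then have "\<pi> Y = x" using c[of x] by simp
      moreover have "0 \<le> q j Y" for j using Y by (auto simp: q_def psd_cone_iff)
      then have "a j \<bullet> x \<le> b j" if "j < f" for j using x that by (metis diff_ge_0_iff_ge)
      ultimately show "\<pi> Y \<in> P" by (simp add: P_iff)
    qed
    show "P \<subseteq> \<pi> ` (psd_cone k \<inter> L)"
    proof
      fix x assume "x \<in> P"
      then have "x \<in> convex hull (p ` {..<v})" using P_eq_convex_hull by simp
      then obtain \<mu> where \<mu>: "\<forall>y\<in>p ` {..<v}. 0 \<le> \<mu> y" "sum \<mu> (p ` {..<v}) = 1"
        "(\<Sum>y\<in>p ` {..<v}. \<mu> y *\<^sub>R y) = x"
        by (auto simp: convex_hull_finite)
      define m where "m = (\<lambda>i. \<mu> (p i))"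
      have inj: "inj_on p {..<v}" using vertices by (simp add: bij_betw_def)
      have m: "\<And>i. i < v \<Longrightarrow> 0 \<le> m i" "(\<Sum>i<v. m i) = 1" "(\<Sum>i<v. m i *\<^sub>R p i) = x"
        using \<mu> by (auto simp: m_def sum.reindex[OF inj])
      \<comment> \<open>The combination of the matrices \<open>u u\<^sup>T\<close> with the weights
        of \<open>x\<close>, where \<open>u\<close> runs over the rows of \<open>U\<close>.\<close>
      define Y where "Y = Matrix.mat k k (\<lambda>(l, r). \<Sum>i<v. m i * (U i l * U i r))"
      have Y_sym: "Y \<in> sym_mats k"
        by (auto simp: Y_def sym_mats_def mult.commute intro!: eq_matI sum.cong)
      have Y_form: "quad_form k Y z = (\<Sum>i<v. m i * (\<Sum>l<k. U i l * z l)\<^sup>2)" for z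
      proof -
        have "quad_form k Y z = (\<Sum>l<k. \<Sum>r<k. \<Sum>i<v. m i * ((U i l * z l) * (U i r * z r)))"
          by (simp add: quad_form_def Y_def sum_distrib_left sum_distrib_right algebra_simps)
        also have "\<dots> = (\<Sum>l<k. \<Sum>i<v. \<Sum>r<k. m i * ((U i l * z l) * (U i r * z r)))"
          by (intro sum.cong sum.swap refl)
        also have "\<dots> = (\<Sum>i<v. \<Sum>l<k. \<Sum>r<k. m i * ((U i l * z l) * (U i r * z r)))"
          by (rule sum.swap)
        also have "\<dots> = (\<Sum>i<v. m i * (\<Sum>l<k. U i l * z l)\<^sup>2)"
          unfolding power2_eq_square sum_product by (simp add: sum_distrib_left)
        finally show ?thesis .
      qed
      have q_Y: "q j Y = b j - a j \<bullet> x" if "j < f" for j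
      proof -
        have "q j Y = (\<Sum>i<v. m i * (b j - a j \<bullet> p i))"
          using fac that by (simp add: q_def Y_form)
        also have "\<dots> = (\<Sum>i<v. m i) * b j - a j \<bullet> (\<Sum>i<v. m i *\<^sub>R p i)"
          by (simp add: inner_sum_right sum_distrib_right sum_subtractf right_diff_distrib)
        finally show ?thesis using m by simp
      qed
      have "Y \<in> L" using Y_sym q_Y unfolding L_def by blast
      moreover have "Y \<in> psd_cone k"
        using Y_sym m(1) by (auto simp: psd_cone_iff Y_form intro!: sum_nonneg)
      moreover have "\<pi> Y = x" using c[of x] q_Y by (simp add: \<pi>_def)
      ultimately show "x \<in> \<pi> ` (psd_cone k \<inter> L)" by blast
    qed
  qed
  ultimately show ?thesis unfolding has_psd_lift_def by blast
qed

text \<open>The square roots of the slacks times the identity matrix form a factorization of size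
  \<open>f\<close>. So the \<open>LEAST\<close> in \<open>psd_rank\<close> is attained.\<close>

lemma ex_psd_lift: "\<exists>k>0. has_psd_lift k P"
proof (intro exI conjI)
  show "0 < f"
  proof (rule ccontr)
    assume "\<not> 0 < f"
    then have "d = 0" for d :: 'a using recession_cone_trivial by simp
    then show False using nonempty_Basis nonzero_Basis by blast
  qed
  show "has_psd_lift f P"
  proof (rule has_psd_lift_of_square_factorization)
    fix i j assume *: "i < v" "j < f"
    have "(\<Sum>l<f. sqrt (b l - a l \<bullet> p i) * of_bool (l = j)) = sqrt (b j - a j \<bullet> p i)"
      using *(2) by (simp add: of_bool_def if_distrib cong: if_cong)
    then show "(\<Sum>l<f. sqrt (b l - a l \<bullet> p i) * of_bool (l = j))\<^sup>2 = b j - a j \<bullet> p i"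
      using vertex_in_P[OF *(1)] *(2) by (simp add: P_iff)
  qed
qed

end

section \<open>Lifts as typed matrices\<close>

text \<open>The zero padding of a lift of size \<open>k\<close> to matrices of the type \<open>real^'m^'m\<close>, the row and
  column indices being enumerated by \<open>e\<close>.\<close>

lemma has_psd_lift_imp_typed:
  fixes P :: "'a::euclidean_space set"
  assumes lift: "has_psd_lift k P" and k: "k \<le> CARD('m::finite)"
  obtains L :: "(real^'m^'m) set" and \<pi> where
    "affine L" "\<forall>Y\<in>L. Finite_Cartesian_Product.transpose Y = Y" "linear \<pi>"
    "P = \<pi> ` {Y \<in> L. psd Y}"
    "k < CARD('m) \<longrightarrow> (\<exists>x. x \<noteq> 0 \<and> (\<forall>Y\<in>L. x \<bullet> (Y *v x) = 0))"
proof -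
  obtain L0 \<pi>0 where L0: "affine_in_sym k L0" "linear_on_sym k \<pi>0" "P = \<pi>0 ` (psd_cone k \<inter> L0)"
    using lift unfolding has_psd_lift_def by blast
  obtain e where e: "bij_betw e {..<CARD('m)} (UNIV :: 'm set)"
    using ex_bij_betw_nat_finite[of "UNIV :: 'm set"] by (auto simp: atLeast0LessThan)
  define ei where "ei = the_inv_into {..<CARD('m)} e"
  have ei: "ei (e l) = l" if "l < CARD('m)" for l
    using e that the_inv_into_f_f unfolding ei_def bij_betw_def by (metis lessThan_iff)
  \<comment> \<open>Symmetrized, so that it is linear and has symmetric values on all matrices; the
    projection must be linear outside \<open>L\<close> as well.\<close>
  define pr :: "real^'m^'m \<Rightarrow> real mat" where
    "pr = (\<lambda>Z. Matrix.mat k k (\<lambda>(l, r). (Z $ e l $ e r + Z $ e r $ e l) / 2))"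
  define L where "L = {Z. Finite_Cartesian_Product.transpose Z = Z \<and> pr Z \<in> L0 \<and>
    (\<forall>i j. k \<le> ei i \<or> k \<le> ei j \<longrightarrow> Z $ i $ j = 0)}"
  define \<pi> where "\<pi> = \<pi>0 \<circ> pr"
  have pr_sym: "pr Z \<in> sym_mats k" for Z
    by (auto simp: pr_def sym_mats_def intro!: eq_matI)
  have pr_add: "pr (Y + Z) = pr Y + pr Z" for Y Z
    by (rule eq_matI) (auto simp: pr_def field_simps)
  have pr_smult: "pr (t *\<^sub>R Z) = t \<cdot>\<^sub>m pr Z" for t Z
    by (rule eq_matI) (auto simp: pr_def field_simps)
  have symm: "Z $ i $ j = Z $ j $ i" if "Z \<in> L" for Z i j
  proof -
    have "Finite_Cartesian_Product.transpose Z $ i $ j = Z $ i $ j" using that by (simp add: L_def)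
    then show ?thesis by (simp add: Finite_Cartesian_Product.transpose_def)
  qed
  have sum_e: "(\<Sum>i\<in>UNIV. g i) = (\<Sum>l<k. g (e l))" if "\<And>i. k \<le> ei i \<Longrightarrow> g i = 0" for g :: "'m \<Rightarrow> real"
  proof -
    have "(\<Sum>i\<in>UNIV. g i) = (\<Sum>l<CARD('m). g (e l))"
      by (rule sum.reindex_bij_betw[OF e, symmetric])
    also have "\<dots> = (\<Sum>l<k. g (e l))"
      using k that ei by (intro sum.mono_neutral_right) auto
    finally show ?thesis .
  qed
  have form: "x \<bullet> (Z *v x) = quad_form k (pr Z) (\<lambda>l. x $ e l)" if "Z \<in> L" for Z x
  proof -
    have z: "Z $ i $ j = 0" if "k \<le> ei i \<or> k \<le> ei j" for i j
      using \<open>Z \<in> L\<close> that unfolding L_def by blast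
    have "x \<bullet> (Z *v x) = (\<Sum>i\<in>UNIV. \<Sum>j\<in>UNIV. x $ i * Z $ i $ j * x $ j)"
      by (simp add: inner_vec_def matrix_vector_mult_def sum_distrib_left mult.assoc)
    also have "\<dots> = (\<Sum>l<k. \<Sum>j\<in>UNIV. x $ e l * Z $ e l $ j * x $ j)"
      using z by (intro sum_e) simp
    also have "\<dots> = (\<Sum>l<k. \<Sum>r<k. x $ e l * Z $ e l $ e r * x $ e r)"
      using z by (intro sum.cong sum_e) auto
    also have "\<dots> = quad_form k (pr Z) (\<lambda>l. x $ e l)"
      unfolding quad_form_def using symm[OF that] by (intro sum.cong) (auto simp: pr_def)
    finally show ?thesis .
  qed
  have psd_iff: "psd Z \<longleftrightarrow> pr Z \<in> psd_cone k" if "Z \<in> L" for Z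
  proof -
    have "quad_form k (pr Z) x = quad_form k (pr Z) (\<lambda>l. (\<chi> i. x (ei i)) $ e l)" for x
      using ei k unfolding quad_form_def by (intro sum.cong) auto
    then have "(\<forall>x. 0 \<le> quad_form k (pr Z) (\<lambda>l. x $ e l)) \<longleftrightarrow> (\<forall>x. 0 \<le> quad_form k (pr Z) x)"
      by metis
    then show ?thesis
      using that pr_sym by (simp add: psd_def psd_cone_iff form L_def)
  qed
  show thesis
  proof (rule that)
    show "affine L"
      unfolding affine_def
    proof (intro ballI allI impI)
      fix Y Z and s t :: real
      assume *: "Y \<in> L" "Z \<in> L" "s + t = 1"
      then have "s \<cdot>\<^sub>m pr Y + t \<cdot>\<^sub>m pr Z \<in> L0"
        using L0(1) unfolding affine_in_sym_def L_def by blast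
      then show "s *\<^sub>R Y + t *\<^sub>R Z \<in> L"
        using * by (auto simp: L_def pr_add pr_smult transpose_linear_combination)
    qed
    show "\<forall>Y\<in>L. Finite_Cartesian_Product.transpose Y = Y"
      by (simp add: L_def)
    show "linear \<pi>"
      using L0(2) pr_sym
      by (intro linearI) (auto simp: \<pi>_def pr_add pr_smult linear_on_sym_def)
    show "P = \<pi> ` {Y \<in> L. psd Y}"
    proof
      show "\<pi> ` {Y \<in> L. psd Y} \<subseteq> P"
        using psd_iff by (auto simp: L0(3) \<pi>_def L_def)
      show "P \<subseteq> \<pi> ` {Y \<in> L. psd Y}"
      proof
        fix x assume "x \<in> P"
        then obtain Y where Y: "Y \<in> psd_cone k" "Y \<in> L0" "x = \<pi>0 Y" using L0(3) by blast
        then have Yc: "Y \<in> carrier_mat k k" "transpose_mat Y = Y"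
          by (auto simp: psd_cone_def sym_mats_def)
        then have Ys: "Y $$ (l, r) = Y $$ (r, l)" if "l < k" "r < k" for l r
          using that by (metis carrier_matD index_transpose_mat(1))
        define Z :: "real^'m^'m" where
          "Z = (\<chi> i j. if ei i < k \<and> ei j < k then Y $$ (ei i, ei j) else 0)"
        have "pr Z = Y"
          using Yc(1) Ys ei k by (intro eq_matI) (auto simp: pr_def Z_def)
        moreover have "Finite_Cartesian_Product.transpose Z = Z"
          using Ys by (auto simp: Z_def Finite_Cartesian_Product.transpose_def
              Finite_Cartesian_Product.vec_eq_iff)
        ultimately have "Z \<in> L" using Y(2) by (auto simp: L_def Z_def)
        then show "x \<in> \<pi> ` {Y \<in> L. psd Y}"
          using psd_iff \<open>pr Z = Y\<close> Y by (auto simp: \<pi>_def)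
      qed
    qed
    show "k < CARD('m) \<longrightarrow> (\<exists>x. x \<noteq> 0 \<and> (\<forall>Y\<in>L. x \<bullet> (Y *v x) = 0))"
    proof (intro impI exI conjI ballI)
      assume "k < CARD('m)"
      \<comment> \<open>The index \<open>e k\<close> belongs to the padding, where all matrices of
        \<open>L\<close> vanish.\<close>
      show "axis (e k) (1::real) \<noteq> 0" by (simp add: axis_eq_0_iff)
      fix Y assume "Y \<in> L"
      have "axis (e k) (1::real) $ e l = 0" if "l < k" for l
      proof -
        have "e l \<noteq> e k" using ei[of l] ei[of k] that \<open>k < CARD('m)\<close> by auto
        then show ?thesis by (simp add: axis_def)
      qed
      then show "axis (e k) (1::real) \<bullet> (Y *v axis (e k) 1) = 0"
        unfolding form[OF \<open>Y \<in> L\<close>] quad_form_def by simp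
    qed
  qed
qed

section \<open>Rank and the main equivalence\<close>

text \<open>The product is a sum of \<open>k\<close> matrices of rank at most one, and rank is
  subadditive.\<close>

lemma mat_rank_le_of_factorization:
  fixes N :: "real mat"
  assumes N: "N \<in> carrier_mat v f"
    and fac: "\<And>i j. i < v \<Longrightarrow> j < f \<Longrightarrow> N $$ (i, j) = (\<Sum>l<k. U i l * W l j)"
  shows "mat_rank N \<le> k"
proof -
  interpret vec_space "TYPE(real)" v .
  define M where "M = (\<lambda>k. Matrix.mat v f (\<lambda>(i, j). \<Sum>l<k. U i l * W l j))"
  have "rank (M k) \<le> k" for k
  proof (induction k)
    case 0
    have "M 0 = 0\<^sub>m v f" by (rule eq_matI) (auto simp: M_def)
    then show ?case by (simp add: rank_0I)
  next
    case (Suc k)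
    define R where "R = Matrix.mat v f (\<lambda>(i, j). U i k * W k j)"
    have "M (Suc k) = M k + R" by (rule eq_matI) (auto simp: M_def R_def)
    moreover have "rank (M k + R) \<le> rank (M k) + rank R"
      by (rule rank_subadditive[of _ f]) (auto simp: M_def R_def)
    moreover have "rank R \<le> 1"
      by (rule rank_le_1_product_entries[of _ f "\<lambda>i. U i k" "\<lambda>j. W k j"]) (auto simp: R_def)
    ultimately show ?case using Suc.IH by simp
  qed
  moreover have "M k = N" using N fac by (intro eq_matI) (auto simp: M_def)
  ultimately show ?thesis using N by (auto simp: mat_rank_def)
qed

text \<open>A maximal independent set \<open>S\<close> of columns spans all columns: its members are
  the left factor, the coefficients the right one.\<close>

lemma factorization_of_mat_rank_le:
  fixes N :: "real mat"
  assumes N: "N \<in> carrier_mat v f" and "mat_rank N \<le> k"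
  obtains U W where "\<forall>i<v. \<forall>j<f. N $$ (i, j) = (\<Sum>l<k. U i l * W l j)"
proof -
  interpret vec_space "TYPE(real)" v .
  have cols: "set (cols N) \<subseteq> carrier_vec v" using N cols_dim by blast
  obtain S where S: "finite S" "maximal S (\<lambda>T. T \<subseteq> set (cols N) \<and> lin_indpt T)"
    using maximal_exists_superset[of "set (cols N)" "\<lambda>T. T \<subseteq> set (cols N) \<and> lin_indpt T" "{}"]
    by (auto simp: lindep_span)
  have SN: "S \<subseteq> set (cols N)" "lin_indpt S" using S(2) by (auto simp: maximal_def)
  have Sv: "S \<subseteq> carrier_vec v" using SN(1) cols by blast
  have card: "card S \<le> k"
    using rank_card_indpt[OF N S(2)] assms by (auto simp: mat_rank_def)
  have "\<exists>c. \<forall>i<v. N $$ (i, j) = (\<Sum>x\<in>S. c x * vec_index x i)" if "j < f" for j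
  proof -
    have col: "col N j \<in> set (cols N)" using N that by (metis carrier_matD(2) cols_length cols_nth nth_mem)
    have "col N j \<in> span S"
    proof (rule ccontr)
      assume no: "col N j \<notin> span S"
      then have "col N j \<notin> S" using span_mem[OF Sv] by blast
      moreover have "lin_indpt (insert (col N j) S)"
        using lin_dep_iff_in_span[OF Sv SN(2) _ \<open>col N j \<notin> S\<close>] no col cols by auto
      ultimately show False using S(2) col SN(1) unfolding maximal_def by blast
    qed
    from finite_in_span[OF S(1) Sv this] obtain c where c: "lincomb c S = col N j" by auto
    then have "N $$ (i, j) = (\<Sum>x\<in>S. c x * vec_index x i)" if "i < v" for i
      using lincomb_index[OF that Sv, of c] N that \<open>j < f\<close> by (simp add: c)
    then show ?thesis by blast
  qed
  then obtain c where c: "\<And>i j. i < v \<Longrightarrow> j < f \<Longrightarrow> N $$ (i, j) = (\<Sum>x\<in>S. c j x * vec_index x i)"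
    by metis
  obtain e where e: "bij_betw e {..<card S} S"
    using ex_bij_betw_nat_finite[OF S(1)] by (auto simp: atLeast0LessThan)
  \<comment> \<open>The left factor is padded with zeros from \<open>card S\<close> up to
    \<open>k\<close>.\<close>
  have "\<forall>i<v. \<forall>j<f. N $$ (i, j) = (\<Sum>l<k. (if l < card S then vec_index (e l) i else 0) * c j (e l))"
  proof (intro allI impI)
    fix i j assume ij: "i < v" "j < f"
    have "N $$ (i, j) = (\<Sum>l<card S. c j (e l) * vec_index (e l) i)"
      unfolding c[OF ij] by (rule sum.reindex_bij_betw[OF e, symmetric])
    also have "\<dots> = (\<Sum>l<k. (if l < card S then vec_index (e l) i else 0) * c j (e l))"
      using card by (intro sum.mono_neutral_cong_left) (auto simp: mult.commute)
    finally show "N $$ (i, j) =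
      (\<Sum>l<k. (if l < card S then vec_index (e l) i else 0) * c j (e l))" .
  qed
  then show thesis by (rule that)
qed

text \<open>A smaller lift, padded to size n + 1, would contain a positive definite matrix, yet the
  padding provides a nonzero vector on which all its forms vanish.\<close>

lemma (in full_dim_slack) psd_lift_size_ge:
  assumes "has_psd_lift k P" "CARD('m::finite) = DIM('a) + 1"
  shows "CARD('m) \<le> k"
proof (rule ccontr)
  assume "\<not> ?thesis"
  then have k: "k < CARD('m)" "k \<le> CARD('m)" by auto
  obtain L :: "(real^'m^'m) set" and \<pi> where L:
    "affine L" "\<forall>Y\<in>L. Finite_Cartesian_Product.transpose Y = Y" "linear \<pi>"
    "P = \<pi> ` {Y \<in> L. psd Y}"
    "k < CARD('m) \<longrightarrow> (\<exists>x. x \<noteq> 0 \<and> (\<forall>Y\<in>L. x \<bullet> (Y *v x) = 0))"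
    by (rule has_psd_lift_imp_typed[OF assms(1) k(2)])
  interpret minimal_psd_lift P L \<pi>
    by (intro minimal_psd_lift.intro polytope full_dim L(1,3,4) assms(2) L(2)[rule_format])
  obtain Y where "Y \<in> L" "psd Y" "\<And>x. Y *v x = 0 \<Longrightarrow> x = 0"
    using positive_definite_in_lift by blast
  then show False using L(5)[rule_format, OF k(1)] psd_null_vector by metis
qed

text \<open>Evaluate the quadratic form of each facet at the rank-one matrix over each
  vertex.\<close>

lemma (in full_dim_slack) square_factorization_of_has_psd_lift:
  assumes "has_psd_lift (CARD('m)) P" "CARD('m::finite) = DIM('a) + 1"
  obtains u w :: "nat \<Rightarrow> real^'m"
  where "\<And>i j. i < v \<Longrightarrow> j < f \<Longrightarrow> (u i \<bullet> w j)\<^sup>2 = b j - a j \<bullet> p i"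
proof -
  obtain L :: "(real^'m^'m) set" and \<pi> where L:
    "affine L" "\<forall>Y\<in>L. Finite_Cartesian_Product.transpose Y = Y" "linear \<pi>"
    "P = \<pi> ` {Y \<in> L. psd Y}"
    by (rule has_psd_lift_imp_typed[OF assms(1) order_refl])
  interpret minimal_psd_lift P L \<pi>
    by (intro minimal_psd_lift.intro polytope full_dim L(1,3,4) assms(2) L(2)[rule_format])
  have "\<exists>X u. X \<in> L \<and> \<pi> X = p i \<and> (\<forall>x. x \<bullet> (X *v x) = (u \<bullet> x)\<^sup>2)" if "i < v" for i
  proof -
    have "p i extreme_point_of P" using vertices that by (auto simp: bij_betw_def)
    then show ?thesis using vertex_rank_one by metis
  qed
  then obtain X u where Xu: "\<And>i. i < v \<Longrightarrow>
      X i \<in> L \<and> \<pi> (X i) = p i \<and> (\<forall>x. x \<bullet> (X i *v x) = (u i \<bullet> x)\<^sup>2)"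
    by metis
  have "\<exists>w. \<forall>Y\<in>L. b j - a j \<bullet> \<pi> Y = w \<bullet> (Y *v w)" if "j < f" for j
  proof -
    have "P \<inter> {x. a j \<bullet> x = b j} facet_of P" using facet_iff that by blast
    moreover have "P \<subseteq> {x. a j \<bullet> x \<le> b j}" using P_iff that by blast
    ultimately show ?thesis using facet_slack_eq_quadratic_form by metis
  qed
  then obtain w where w: "\<And>j Y. j < f \<Longrightarrow> Y \<in> L \<Longrightarrow> b j - a j \<bullet> \<pi> Y = w j \<bullet> (Y *v w j)"
    by metis
  have "(u i \<bullet> w j)\<^sup>2 = b j - a j \<bullet> p i" if "i < v" "j < f" for i j
    using w[OF that(2), of "X i"] Xu[OF that(1)] by simp
  then show thesis by (rule that)
qed

text \<open>Reduces statements about \<open>psd_rank\<close> and \<open>sqrt_rank\<close> to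
  attainment of n + 1, once it is known to be a lower bound.\<close>

lemma Least_eq_iff_of_lower_bound:
  fixes Q :: "nat \<Rightarrow> bool"
  assumes "\<exists>r. Q r" "\<And>r. Q r \<Longrightarrow> m \<le> r"
  shows "(LEAST r. Q r) = m \<longleftrightarrow> Q m"
  using assms by (metis LeastI_ex Least_equality)

theorem theorem3p5:
  fixes P :: "(real ^ 'n) set" and S :: "real mat"
  assumes "polytope P"
    and "aff_dim P = int CARD('n)"
    and "slack_matrix P S"
  shows "psd_rank P = CARD('n) + 1 \<longleftrightarrow> sqrt_rank S = CARD('n) + 1"
proof -
  obtain v f p a b where p: "bij_betw p {..<v} {x. x extreme_point_of P}"
    and rep: "irredundant_rep P f a b"
    and S: "S = Matrix.mat v f (\<lambda>(i, j). b j - inner (a j) (p i))"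
    using assms(3) unfolding slack_matrix_def by blast
  interpret full_dim_slack P f a b v p
    by unfold_locales (use assms p rep in auto)
  \<comment> \<open>The type \<open>'n option\<close> supplies n + 1 matrix indices.\<close>
  have card: "CARD('n option) = DIM(real^'n) + 1" by simp
  have hadamard: "hadamard_sqrt S N \<longleftrightarrow> N \<in> carrier_mat v f \<and>
      (\<forall>i<v. \<forall>j<f. (N $$ (i, j))\<^sup>2 = b j - a j \<bullet> p i)" for N
    by (auto simp: hadamard_sqrt_def S)
  have "psd_rank P = CARD('n) + 1 \<longleftrightarrow> 0 < CARD('n) + 1 \<and> has_psd_lift (CARD('n) + 1) P"
    unfolding psd_rank_def
  proof (rule Least_eq_iff_of_lower_bound)
    show "\<exists>k. 0 < k \<and> has_psd_lift k P" using ex_psd_lift .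
    show "CARD('n) + 1 \<le> k" if "0 < k \<and> has_psd_lift k P" for k
      using psd_lift_size_ge[OF _ card, of k] that by simp
  qed
  also have "\<dots> \<longleftrightarrow> has_psd_lift (CARD('n) + 1) P" by simp
  also have "\<dots> \<longleftrightarrow> (\<exists>N. hadamard_sqrt S N \<and> mat_rank N \<le> CARD('n) + 1)"
  proof
    assume "has_psd_lift (CARD('n) + 1) P"
    then have "has_psd_lift CARD('n option) P" by simp
    then obtain u w :: "nat \<Rightarrow> real^('n option)" where
      uw: "\<And>i j. i < v \<Longrightarrow> j < f \<Longrightarrow> (u i \<bullet> w j)\<^sup>2 = b j - a j \<bullet> p i"
      using square_factorization_of_has_psd_lift[OF _ card] by blast
    obtain U W where UW: "\<And>i j. u i \<bullet> w j = (\<Sum>l<DIM(real^('n option)). U i l * W l j)"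
      using inner_as_sum[of u w] by blast
    define N where "N = Matrix.mat v f (\<lambda>(i, j). u i \<bullet> w j)"
    have "hadamard_sqrt S N" using uw by (simp add: hadamard N_def)
    moreover have "mat_rank N \<le> DIM(real^('n option))"
      by (rule mat_rank_le_of_factorization[where v = v and f = f and U = U and W = W]) (simp_all add: N_def UW)
    ultimately show "\<exists>N. hadamard_sqrt S N \<and> mat_rank N \<le> CARD('n) + 1" by auto
  next
    assume "\<exists>N. hadamard_sqrt S N \<and> mat_rank N \<le> CARD('n) + 1"
    then obtain N where N: "hadamard_sqrt S N" "mat_rank N \<le> CARD('n) + 1" by blast
    have "N \<in> carrier_mat v f" using N(1) by (simp add: hadamard)
    then obtain U W where
      UW: "\<forall>i<v. \<forall>j<f. N $$ (i, j) = (\<Sum>l<CARD('n) + 1. U i l * W l j)"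
      using N(2) by (rule factorization_of_mat_rank_le)
    show "has_psd_lift (CARD('n) + 1) P"
    proof (rule has_psd_lift_of_square_factorization)
      show "(\<Sum>l<CARD('n) + 1. U i l * W l j)\<^sup>2 = b j - a j \<bullet> p i" if "i < v" "j < f" for i j
        using N(1) UW[rule_format, OF that] that by (metis hadamard)
    qed
  qed
  also have "\<dots> \<longleftrightarrow> sqrt_rank S = CARD('n) + 1"
  proof -
    have ge: "CARD('n) + 1 \<le> mat_rank N" if N: "hadamard_sqrt S N" for N
    proof (rule ccontr)
      assume "\<not> ?thesis"
      then have rank: "mat_rank N \<le> CARD('n)" by simp
      have "N \<in> carrier_mat v f" using N by (simp add: hadamard)
      then obtain U W where
        UW: "\<forall>i<v. \<forall>j<f. N $$ (i, j) = (\<Sum>l<CARD('n). U i l * W l j)"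
        using rank by (rule factorization_of_mat_rank_le)
      obtain u w :: "nat \<Rightarrow> real^'n" where
        uw: "\<forall>i j. u i \<bullet> w j = (\<Sum>l<CARD('n). U i l * W l j)"
        by (rule sum_as_inner[where 'e = "real^'n" and k = "CARD('n)"]) simp
      show False
      proof (rule zero_pattern_not_realizable)
        fix i j assume *: "i < v" "j < f"
        have "u i \<bullet> w j = N $$ (i, j)" using UW[rule_format, OF *] uw by simp
        moreover have "(N $$ (i, j))\<^sup>2 = b j - a j \<bullet> p i" using N * by (metis hadamard)
        ultimately have "(u i \<bullet> w j)\<^sup>2 = b j - a j \<bullet> p i" by simp
        then show "u i \<bullet> w j = 0 \<longleftrightarrow> a j \<bullet> p i = b j" by auto
      qed
    qed
    \<comment> \<open>The entrywise nonnegative root shows that some Hadamard square root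
      exists.\<close>
    define N0 where "N0 = Matrix.mat v f (\<lambda>(i, j). sqrt (b j - a j \<bullet> p i))"
    have "hadamard_sqrt S N0"
      using vertex_in_P by (auto simp: hadamard N0_def P_iff)
    then have eq: "sqrt_rank S = CARD('n) + 1 \<longleftrightarrow>
        (\<exists>N. hadamard_sqrt S N \<and> mat_rank N = CARD('n) + 1)"
      unfolding sqrt_rank_def using ge by (intro Least_eq_iff_of_lower_bound) auto
    show ?thesis
      \<comment> \<open>The lower bound \<open>ge\<close> turns rank at most n + 1 into
        equality.\<close>
      unfolding eq by (rule iff_exI) (metis ge le_antisym order_refl)
  qed
  finally show ?thesis .
qed

end
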